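(* Let $A$ be a function algebra on a compact Hausdorff space $K$ such that its Choquet boundary $\partial A$ does not contain an isolated point. Then every operator $T\in L(A)$ which is weakly compact or factors through a closed subspace of $c_0$ satisfies $\|\mathrm{Id}+T\|=1+\|T\|$.
   Context: A function algebra on $K$ is a closed subalgebra $A$ of the space $C(K)$ of complex-valued continuous functions (sup norm) that separates the points of $K$ and contains the constants. Its Choquet boundary is $\partial A=\{k\in K: \delta_k|_A \text{ is an extreme point of the closed unit ball of } A^*\}$, with the topology induced from $K$. $T$ factors through a subspace of $c_0$ if $T=T_2T_1$ with bounded $T_1\colon A\to E$, $T_2\colon E\to A$, $E\subset c_0$ closed. *)

theory Defs
  imports "HOL-Analysis.Analysis"
begin

definition supn :: "('b \<Rightarrow> complex) \<Rightarrow> real" where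
  "supn f = (SUP x. cmod (f x))"

definition complex_subspace :: "('b \<Rightarrow> complex) set \<Rightarrow> bool" where
  "complex_subspace S \<longleftrightarrow> (\<lambda>x. 0) \<in> S \<and>
     (\<forall>f\<in>S. \<forall>g\<in>S. (\<lambda>x. f x + g x) \<in> S) \<and>
     (\<forall>c. \<forall>f\<in>S. (\<lambda>x. c * f x) \<in> S)"

definition bdd_lin :: "('b \<Rightarrow> complex) set \<Rightarrow> ('c \<Rightarrow> complex) set
    \<Rightarrow> (('b \<Rightarrow> complex) \<Rightarrow> ('c \<Rightarrow> complex)) \<Rightarrow> bool" where
  "bdd_lin S S' F \<longleftrightarrow> (\<forall>f\<in>S. F f \<in> S') \<and>
     (\<forall>f\<in>S. \<forall>g\<in>S. F (\<lambda>x. f x + g x) = (\<lambda>y. F f y + F g y)) \<and>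
     (\<forall>c. \<forall>f\<in>S. F (\<lambda>x. c * f x) = (\<lambda>y. c * F f y)) \<and>
     (\<exists>C. \<forall>f\<in>S. supn (F f) \<le> C * supn f)"

definition opnorm :: "('b \<Rightarrow> complex) set \<Rightarrow> (('b \<Rightarrow> complex) \<Rightarrow> ('b \<Rightarrow> complex)) \<Rightarrow> real" where
  "opnorm A T = Sup {supn (T f) | f. f \<in> A \<and> supn f \<le> 1}"

text \<open>Function algebra on the compact Hausdorff space given by the type 'a.\<close>
definition function_algebra :: "('a::topological_space \<Rightarrow> complex) set \<Rightarrow> bool" where
  "function_algebra A \<longleftrightarrow>
     A \<subseteq> {f. continuous_on UNIV f} \<and>
     (\<forall>c. (\<lambda>x. c) \<in> A) \<and>
     (\<forall>f\<in>A. \<forall>g\<in>A. (\<lambda>x. f x + g x) \<in> A) \<and>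
     (\<forall>f\<in>A. \<forall>g\<in>A. (\<lambda>x. f x * g x) \<in> A) \<and>
     (\<forall>c. \<forall>f\<in>A. (\<lambda>x. c * f x) \<in> A) \<and>
     (\<forall>X l. (\<forall>n. X n \<in> A) \<and> continuous_on UNIV l \<and>
            (\<lambda>n. supn (\<lambda>x. X n x - l x)) \<longlonglongrightarrow> 0 \<longrightarrow> l \<in> A) \<and>
     (\<forall>x y. x \<noteq> y \<longrightarrow> (\<exists>f\<in>A. f x \<noteq> f y))"

definition dual_space :: "('b \<Rightarrow> complex) set \<Rightarrow> (('b \<Rightarrow> complex) \<Rightarrow> complex) set" where
  "dual_space A = {\<phi>. (\<forall>f\<in>A. \<forall>g\<in>A. \<phi> (\<lambda>x. f x + g x) = \<phi> f + \<phi> g) \<and>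
                      (\<forall>c. \<forall>f\<in>A. \<phi> (\<lambda>x. c * f x) = c * \<phi> f) \<and>
                      (\<exists>C. \<forall>f\<in>A. cmod (\<phi> f) \<le> C * supn f)}"

definition dual_ball :: "('b \<Rightarrow> complex) set \<Rightarrow> (('b \<Rightarrow> complex) \<Rightarrow> complex) set" where
  "dual_ball A = {\<phi> \<in> dual_space A. \<forall>f\<in>A. cmod (\<phi> f) \<le> supn f}"

definition extreme_in_dual_ball :: "('b \<Rightarrow> complex) set \<Rightarrow> (('b \<Rightarrow> complex) \<Rightarrow> complex) \<Rightarrow> bool" where
  "extreme_in_dual_ball A \<psi> \<longleftrightarrow> \<psi> \<in> dual_ball A \<and>
     (\<forall>\<phi>1\<in>dual_ball A. \<forall>\<phi>2\<in>dual_ball A. \<forall>t::real. 0 < t \<and> t < 1 \<and>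
        (\<forall>f\<in>A. \<psi> f = of_real t * \<phi>1 f + of_real (1 - t) * \<phi>2 f)
        \<longrightarrow> (\<forall>f\<in>A. \<phi>1 f = \<phi>2 f))"

definition choquet_boundary :: "('a \<Rightarrow> complex) set \<Rightarrow> 'a set" where
  "choquet_boundary A = {k. extreme_in_dual_ball A (\<lambda>f. f k)}"

definition isolated_point :: "'a::topological_space \<Rightarrow> 'a set \<Rightarrow> bool" where
  "isolated_point k S \<longleftrightarrow> k \<in> S \<and> (\<exists>U. open U \<and> U \<inter> S = {k})"

definition weak_topology :: "('b \<Rightarrow> complex) set \<Rightarrow> ('b \<Rightarrow> complex) topology" where
  "weak_topology A = topology_generated_by
     {{f\<in>A. \<phi> f \<in> U} | \<phi> U. \<phi> \<in> dual_space A \<and> open U}"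

definition weakly_compact_op :: "('b \<Rightarrow> complex) set \<Rightarrow> (('b \<Rightarrow> complex) \<Rightarrow> ('b \<Rightarrow> complex)) \<Rightarrow> bool" where
  "weakly_compact_op A T \<longleftrightarrow>
     compactin (weak_topology A) (weak_topology A closure_of (T ` {f\<in>A. supn f \<le> 1}))"

definition c0 :: "(nat \<Rightarrow> complex) set" where
  "c0 = {x. x \<longlonglongrightarrow> 0}"

definition factors_through_c0_subspace :: "('b \<Rightarrow> complex) set \<Rightarrow> (('b \<Rightarrow> complex) \<Rightarrow> ('b \<Rightarrow> complex)) \<Rightarrow> bool" where
  "factors_through_c0_subspace A T \<longleftrightarrow>
     (\<exists>E T1 T2. E \<subseteq> c0 \<and> complex_subspace E \<and>
        (\<forall>X l. (\<forall>n. X n \<in> E) \<and> l \<in> c0 \<and> (\<lambda>n. supn (\<lambda>i. X n i - l i)) \<longlonglongrightarrow> 0 \<longrightarrow> l \<in> E) \<and>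
        bdd_lin A E T1 \<and> bdd_lin E A T2 \<and> (\<forall>f\<in>A. T f = T2 (T1 f)))"

end

theory Submission
  imports Defs
begin

text \<open>
  For a point \<open>s\<close> of the Choquet boundary and a neighbourhood \<open>V\<close> of it there are \<open>h \<in> A\<close> with
  \<open>h s \<approx> 1\<close>, \<open>h \<approx> 0\<close> off \<open>V\<close> and \<open>\<bar>h\<bar> + \<bar>1 - h\<bar> \<le> 1 + e\<close> (peakers). If \<open>f\<close> in the unit ball almost
  attains the norm of \<open>T\<close> at \<open>s\<close> and \<open>T h s\<close> is small for some peakers \<open>h\<close>, then
  \<open>f (1 - h) + \<theta> h\<close>, with \<open>\<theta>\<close> the phase of \<open>T f s\<close>, almost attains \<open>1 + \<parallel>T\<parallel>\<close> under \<open>Id + T\<close>. As the set of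
  norming points is open in the boundary, it suffices to find such \<open>s\<close> in every nonempty open part of it.

  Peakers at distinct points are almost disjointly supported, so a functional is large on the peakers
  of only finitely many points. If \<open>T\<close> is weakly compact and \<open>T h s\<close> is large at all \<open>s\<close> of an open
  set, the weak cluster points \<open>G s\<close> of \<open>T h\<close> are continuous, and one finds arbitrarily many points \<open>s\<close>
  whose \<open>G s\<close> are all large at one common point: a contradiction. If \<open>T\<close> factors through \<open>c0\<close>, the
  coordinate functionals are large only at countably many points; such a set has dense complement
  because the Choquet boundary is a Baire space without isolated points, and at a point outside of it a
  gliding hump argument produces averages of peakers with small image.
\<close>


section \<open>The Hahn-Banach theorem for function spaces\<close>

definition sublinear_on :: "('a \<Rightarrow> real) set \<Rightarrow> (('a \<Rightarrow> real) \<Rightarrow> real) \<Rightarrow> bool" where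
  "sublinear_on V q \<longleftrightarrow>
     (\<forall>u\<in>V. \<forall>w\<in>V. q (\<lambda>x. u x + w x) \<le> q u + q w) \<and>
     (\<forall>c>0. \<forall>u\<in>V. q (\<lambda>x. c * u x) = c * q u)"

locale real_function_space =
  fixes V :: "('a \<Rightarrow> real) set"
  assumes zero_mem: "(\<lambda>x. 0) \<in> V"
    and add_mem: "u \<in> V \<Longrightarrow> w \<in> V \<Longrightarrow> (\<lambda>x. u x + w x) \<in> V"
    and scale_mem: "u \<in> V \<Longrightarrow> (\<lambda>x. c * u x) \<in> V"
begin

lemma neg_mem: "u \<in> V \<Longrightarrow> (\<lambda>x. - u x) \<in> V"
  using scale_mem[of u "-1"] by simp

lemma sublinear_add:
  "sublinear_on V q \<Longrightarrow> u \<in> V \<Longrightarrow> w \<in> V \<Longrightarrow> q (\<lambda>x. u x + w x) \<le> q u + q w"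
  by (simp add: sublinear_on_def)

lemma sublinear_scale:
  "sublinear_on V q \<Longrightarrow> u \<in> V \<Longrightarrow> c > 0 \<Longrightarrow> q (\<lambda>x. c * u x) = c * q u"
  by (simp add: sublinear_on_def)

lemma sublinear_zero: "sublinear_on V q \<Longrightarrow> q (\<lambda>x. 0) = 0"
  using sublinear_scale[of q "\<lambda>x. 0" 2] zero_mem by simp

lemma sublinear_scale_nonneg:
  "sublinear_on V q \<Longrightarrow> u \<in> V \<Longrightarrow> c \<ge> 0 \<Longrightarrow> q (\<lambda>x. c * u x) = c * q u"
  using sublinear_scale[of q u c] sublinear_zero[of q] by (cases "c = 0") auto

lemma sublinear_neg_lower: "sublinear_on V q \<Longrightarrow> u \<in> V \<Longrightarrow> - q (\<lambda>x. - u x) \<le> q u"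
  using sublinear_add[of q u "\<lambda>x. - u x"] neg_mem[of u] sublinear_zero[of q] by simp

text \<open>For sublinear \<open>q\<close> and \<open>v\<close> in \<open>V\<close> this is the
  largest sublinear functional below \<open>q\<close> whose value at \<open>- v\<close> is at most
  \<open>- q v\<close>.\<close>

definition tilt :: "(('a \<Rightarrow> real) \<Rightarrow> real) \<Rightarrow> ('a \<Rightarrow> real) \<Rightarrow> ('a \<Rightarrow> real) \<Rightarrow> real" where
  "tilt q v u = (if u \<in> V then INF t\<in>{0..}. q (\<lambda>x. u x + t * v x) - t * q v else 0)"

lemma tilt_bdd_below:
  assumes q: "sublinear_on V q" and v: "v \<in> V" and u: "u \<in> V"
  shows "bdd_below ((\<lambda>t. q (\<lambda>x. u x + t * v x) - t * q v) ` {0..})"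
proof (rule bdd_belowI2)
  fix t :: real
  assume t: "t \<in> {0..}"
  have "t * q v = q (\<lambda>x. t * v x)"
    using sublinear_scale_nonneg[OF q v] t by simp
  also have "(\<lambda>x. t * v x) = (\<lambda>x. (u x + t * v x) + - u x)" by simp
  also have "q \<dots> \<le> q (\<lambda>x. u x + t * v x) + q (\<lambda>x. - u x)"
    by (intro sublinear_add[OF q] add_mem scale_mem neg_mem u v)
  finally show "- q (\<lambda>x. - u x) \<le> q (\<lambda>x. u x + t * v x) - t * q v" by simp
qed

lemma tilt_le:
  assumes "sublinear_on V q" "v \<in> V" "u \<in> V" "t \<ge> 0"
  shows "tilt q v u \<le> q (\<lambda>x. u x + t * v x) - t * q v"
  using assms tilt_bdd_below[of q v u] by (auto simp: tilt_def intro!: cINF_lower)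

lemma tilt_greatest:
  assumes "u \<in> V" "\<And>t. t \<ge> 0 \<Longrightarrow> c \<le> q (\<lambda>x. u x + t * v x) - t * q v"
  shows "c \<le> tilt q v u"
  using assms by (auto simp: tilt_def intro!: cINF_greatest)

text \<open>Parameters \<open>s\<close> for \<open>u\<close> and \<open>t\<close> for
  \<open>w\<close> combine to \<open>s + t\<close> for the sum; the infima are then taken one after
  the other. For homogeneity \<open>t\<close> is rescaled to \<open>c t\<close>, and the
  inequalities for \<open>c\<close> and \<open>1 / c\<close> give equality.\<close>

lemma sublinear_tilt:
  assumes q: "sublinear_on V q" and v: "v \<in> V"
  shows "sublinear_on V (tilt q v)"
  unfolding sublinear_on_def
proof (intro conjI ballI allI impI)
  fix u w assume u: "u \<in> V" and w: "w \<in> V"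
  have uw: "(\<lambda>x. u x + w x) \<in> V" by (rule add_mem[OF u w])
  have key: "tilt q v (\<lambda>x. u x + w x) \<le>
      (q (\<lambda>x. u x + s * v x) - s * q v) + (q (\<lambda>x. w x + t * v x) - t * q v)"
    if "s \<ge> 0" "t \<ge> 0" for s t
  proof -
    have "tilt q v (\<lambda>x. u x + w x) \<le> q (\<lambda>x. (u x + w x) + (s + t) * v x) - (s + t) * q v"
      using tilt_le[OF q v uw] that by simp
    also have "(\<lambda>x. (u x + w x) + (s + t) * v x) = (\<lambda>x. (u x + s * v x) + (w x + t * v x))"
      by (simp add: algebra_simps)
    also have "q \<dots> \<le> q (\<lambda>x. u x + s * v x) + q (\<lambda>x. w x + t * v x)"
      by (intro sublinear_add[OF q] add_mem scale_mem u v w)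
    finally show ?thesis by (simp add: algebra_simps)
  qed
  have "tilt q v (\<lambda>x. u x + w x) - (q (\<lambda>x. w x + t * v x) - t * q v) \<le> tilt q v u"
    if "t \<ge> 0" for t
    by (rule tilt_greatest[OF u], rule diff_le_eq[THEN iffD2], rule key[OF _ that])
  then have "tilt q v (\<lambda>x. u x + w x) - tilt q v u \<le> tilt q v w"
    by (intro tilt_greatest[OF w]) (simp add: algebra_simps)
  then show "tilt q v (\<lambda>x. u x + w x) \<le> tilt q v u + tilt q v w" by simp
next
  have le: "tilt q v (\<lambda>x. c * u x) \<le> c * tilt q v u" if u: "u \<in> V" and c: "c > 0" for u c
  proof -
    have "tilt q v (\<lambda>x. c * u x) / c \<le> q (\<lambda>x. u x + t * v x) - t * q v" if "t \<ge> 0" for t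
    proof -
      have "tilt q v (\<lambda>x. c * u x) \<le> q (\<lambda>x. c * u x + (c * t) * v x) - (c * t) * q v"
        by (rule tilt_le[OF q v scale_mem[OF u]]) (use that c in simp)
      also have "(\<lambda>x. c * u x + (c * t) * v x) = (\<lambda>x. c * (u x + t * v x))"
        by (simp add: algebra_simps)
      also have "q \<dots> = c * q (\<lambda>x. u x + t * v x)"
        by (intro sublinear_scale[OF q] add_mem scale_mem u v c)
      finally show ?thesis using c by (simp add: field_simps)
    qed
    then have "tilt q v (\<lambda>x. c * u x) / c \<le> tilt q v u" by (rule tilt_greatest[OF u])
    then show ?thesis using c by (simp add: field_simps)
  qed
  fix c :: real and u assume c: "c > 0" and u: "u \<in> V"
  have "tilt q v (\<lambda>x. (1 / c) * (c * u x)) \<le> (1 / c) * tilt q v (\<lambda>x. c * u x)"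
    by (rule le[OF scale_mem[OF u]]) (use c in simp)
  moreover have "(\<lambda>x. (1 / c) * (c * u x)) = u" using c by auto
  ultimately have "c * tilt q v u \<le> tilt q v (\<lambda>x. c * u x)"
    using c by (simp add: field_simps)
  with le[OF u c] show "tilt q v (\<lambda>x. c * u x) = c * tilt q v u" by simp
qed

lemma tilt_le_self: "sublinear_on V q \<Longrightarrow> v \<in> V \<Longrightarrow> u \<in> V \<Longrightarrow> tilt q v u \<le> q u"
  using tilt_le[of q v u 0] by simp

lemma tilt_neg: "sublinear_on V q \<Longrightarrow> v \<in> V \<Longrightarrow> tilt q v (\<lambda>x. - v x) \<le> - q v"
  using tilt_le[of q v "\<lambda>x. - v x" 1] neg_mem[of v] sublinear_zero[of q] by simp

text \<open>Zorn's lemma downwards: the infimum of a chain is finite because all members are at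
  least \<open>- p (- u)\<close> at \<open>u\<close>, and it is subadditive because two members have
  a common lower one.\<close>

lemma ex_minimal_sublinear:
  assumes p: "sublinear_on V p"
  obtains m where "sublinear_on V m" "\<And>u. u \<in> V \<Longrightarrow> m u \<le> p u"
    "\<And>q. sublinear_on V q \<Longrightarrow> \<forall>u\<in>V. q u \<le> m u \<Longrightarrow> \<forall>u\<in>V. q u = m u"
proof -
  \<comment> \<open>Normalising to 0 off \<open>V\<close> turns comparison on \<open>V\<close> into
    the pointwise order of functions.\<close>
  define P where "P = {q. sublinear_on V q \<and> (\<forall>u\<in>V. q u \<le> p u) \<and> (\<forall>u. u \<notin> V \<longrightarrow> q u = 0)}"
  let ?cut = "\<lambda>q u. if u \<in> V then q u else (0::real)"
  have cut: "sublinear_on V (?cut q)" if "sublinear_on V q" for q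
    using that by (simp add: sublinear_on_def add_mem scale_mem)
  have "\<exists>m\<in>P. \<forall>q\<in>P. (\<ge>) m q \<longrightarrow> q = m"
  proof (rule predicate_Zorn)
    show "partial_order_on P (relation_of (\<ge>) P)"
      by (rule partial_order_on_relation_ofI) auto
  next
    fix C assume "C \<in> Chains (relation_of (\<ge>) P)"
    then have CP: "C \<subseteq> P" and chain: "\<And>q r. q \<in> C \<Longrightarrow> r \<in> C \<Longrightarrow> q \<le> r \<or> r \<le> q"
      by (auto simp: Chains_def relation_of_def)
    show "\<exists>u\<in>P. \<forall>a\<in>C. a \<ge> u"
    proof (cases "C = {}")
      case True
      have "?cut p \<in> P" using cut[OF p] by (simp add: P_def)
      then show ?thesis using True by auto
    next
      case False
      define r where "r = ?cut (\<lambda>u. INF q\<in>C. q u)"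
      have C: "sublinear_on V q" "\<And>u. u \<in> V \<Longrightarrow> q u \<le> p u" "\<And>u. u \<notin> V \<Longrightarrow> q u = 0" if "q \<in> C" for q
        using that CP by (auto simp: P_def)
      have bdd: "bdd_below ((\<lambda>q. q u) ` C)" if u: "u \<in> V" for u
      proof (rule bdd_belowI2)
        fix q assume "q \<in> C"
        show "- p (\<lambda>x. - u x) \<le> q u"
          using sublinear_neg_lower[OF C(1)[OF \<open>q \<in> C\<close>] u] C(2)[OF \<open>q \<in> C\<close> neg_mem[OF u]] by simp
      qed
      have low: "r u \<le> q u" if "q \<in> C" "u \<in> V" for q u
        using that bdd by (auto simp: r_def intro!: cINF_lower)
      have great: "c \<le> r u" if "u \<in> V" "\<And>q. q \<in> C \<Longrightarrow> c \<le> q u" for c u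
        using that False by (auto simp: r_def intro!: cINF_greatest)
      have "sublinear_on V r"
        unfolding sublinear_on_def
      proof (intro conjI ballI allI impI)
        fix u w assume u: "u \<in> V" and w: "w \<in> V"
        have key: "r (\<lambda>x. u x + w x) \<le> q1 u + q2 w" if q: "q1 \<in> C" "q2 \<in> C" for q1 q2
        proof -
          obtain q where "q \<in> C" "q \<le> q1" "q \<le> q2" using chain[OF q] q by blast
          show ?thesis
            using low[OF \<open>q \<in> C\<close> add_mem[OF u w]] sublinear_add[OF C(1)[OF \<open>q \<in> C\<close>] u w]
              le_funD[OF \<open>q \<le> q1\<close>, of u] le_funD[OF \<open>q \<le> q2\<close>, of w] by linarith
        qed
        have "r (\<lambda>x. u x + w x) - q2 w \<le> r u" if "q2 \<in> C" for q2
          by (rule great[OF u], rule diff_le_eq[THEN iffD2], rule key[OF _ that])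
        then have "r (\<lambda>x. u x + w x) - r u \<le> r w"
          by (intro great[OF w]) (simp add: algebra_simps)
        then show "r (\<lambda>x. u x + w x) \<le> r u + r w" by simp
      next
        have le: "r (\<lambda>x. c * u x) \<le> c * r u" if u: "u \<in> V" and c: "c > 0" for u c
        proof -
          have "r (\<lambda>x. c * u x) / c \<le> q u" if "q \<in> C" for q
            using low[OF that scale_mem[OF u, of c]] sublinear_scale[OF C(1)[OF that] u c] c
            by (simp add: field_simps)
          then have "r (\<lambda>x. c * u x) / c \<le> r u" by (rule great[OF u])
          then show ?thesis using c by (simp add: field_simps)
        qed
        fix c :: real and u assume c: "c > 0" and u: "u \<in> V"
        have "r (\<lambda>x. (1 / c) * (c * u x)) \<le> (1 / c) * r (\<lambda>x. c * u x)"
          by (rule le[OF scale_mem[OF u]]) (use c in simp)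
        moreover have "(\<lambda>x. (1 / c) * (c * u x)) = u" using c by auto
        ultimately have "c * r u \<le> r (\<lambda>x. c * u x)"
          using c by (simp add: field_simps)
        with le[OF u c] show "r (\<lambda>x. c * u x) = c * r u" by simp
      qed
      moreover have "r u \<le> p u" if "u \<in> V" for u
      proof -
        obtain q where "q \<in> C" using False by auto
        then show ?thesis using low[of q u] C(2)[of q u] that by simp
      qed
      ultimately have "r \<in> P" by (simp add: P_def r_def)
      moreover have "r \<le> q" if "q \<in> C" for q
        using low[OF that] C(3)[OF that] by (auto simp: le_fun_def r_def)
      ultimately show ?thesis by auto
    qed
  qed
  then obtain m where m: "m \<in> P" and min: "\<And>q. q \<in> P \<Longrightarrow> q \<le> m \<Longrightarrow> q = m" by auto
  show thesis
  proof (rule that)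
    show "sublinear_on V m" "\<And>u. u \<in> V \<Longrightarrow> m u \<le> p u" using m by (auto simp: P_def)
    fix q assume q: "sublinear_on V q" "\<forall>u\<in>V. q u \<le> m u"
    have "?cut q \<in> P" using m order_trans[OF bspec[OF q(2)]] cut[OF q(1)] by (simp add: P_def)
    moreover have "?cut q \<le> m" using m q(2) by (auto simp: le_fun_def P_def)
    ultimately have "?cut q = m" by (rule min)
    from fun_cong[OF this] show "\<forall>u\<in>V. q u = m u" by metis
  qed
qed

text \<open>A minimal sublinear functional is linear, because it coincides with all its tilts.\<close>
theorem Hahn_Banach:
  assumes p: "sublinear_on V p" and v: "v \<in> V"
  obtains L where "\<And>u. u \<in> V \<Longrightarrow> L u \<le> p u" "L v = p v"
    "\<And>u w. u \<in> V \<Longrightarrow> w \<in> V \<Longrightarrow> L (\<lambda>x. u x + w x) = L u + L w"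
    "\<And>c u. u \<in> V \<Longrightarrow> L (\<lambda>x. c * u x) = c * L u"
proof -
  \<comment> \<open>The minimal functional is taken below the tilt of \<open>p\<close> rather than
    below \<open>p\<close>: this gives \<open>m (- v) \<le> - p v\<close>, and with oddness
    \<open>m v = p v\<close>.\<close>
  obtain m where m: "sublinear_on V m" and mp: "\<And>u. u \<in> V \<Longrightarrow> m u \<le> tilt p v u"
    and min: "\<And>q. sublinear_on V q \<Longrightarrow> \<forall>u\<in>V. q u \<le> m u \<Longrightarrow> \<forall>u\<in>V. q u = m u"
    by (rule ex_minimal_sublinear[OF sublinear_tilt[OF p v]]) blast
  have neg: "m (\<lambda>x. - w x) = - m w" if w: "w \<in> V" for w
  proof -
    have "tilt m w (\<lambda>x. - w x) = m (\<lambda>x. - w x)"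
      using min[OF sublinear_tilt[OF m w]] tilt_le_self[OF m w] neg_mem[OF w] by blast
    then show ?thesis using tilt_neg[OF m w] sublinear_neg_lower[OF m w] by simp
  qed
  have le: "m u \<le> p u" if "u \<in> V" for u
    using mp[OF that] tilt_le_self[OF p v that] by simp
  have "m (\<lambda>x. - v x) \<le> - p v"
    using mp[OF neg_mem[OF v]] tilt_neg[OF p v] by simp
  then have mv: "m v = p v" using neg[OF v] le[OF v] by simp
  have add: "m (\<lambda>x. u x + w x) = m u + m w" if u: "u \<in> V" and w: "w \<in> V" for u w
  proof -
    have "m (\<lambda>x. (u x + w x) + - w x) \<le> m (\<lambda>x. u x + w x) + m (\<lambda>x. - w x)"
      by (intro sublinear_add[OF m] add_mem neg_mem u w)
    then show ?thesis using neg[OF w] sublinear_add[OF m u w] by simp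
  qed
  have scale: "m (\<lambda>x. c * u x) = c * m u" if u: "u \<in> V" for c u
  proof (cases "c \<ge> 0")
    case True
    then show ?thesis by (rule sublinear_scale_nonneg[OF m u])
  next
    case False
    then have "m (\<lambda>x. - c * u x) = - c * m u" by (intro sublinear_scale_nonneg[OF m u]) simp
    moreover have "m (\<lambda>x. - (c * u x)) = - m (\<lambda>x. c * u x)" by (rule neg[OF scale_mem[OF u]])
    ultimately show ?thesis by simp
  qed
  show thesis by (rule that[OF le mv add scale])
qed

end

lemma bounded_real_function_space: "real_function_space {u :: 'b \<Rightarrow> real. bounded (range u)}"
proof
  fix u w :: "'b \<Rightarrow> real" and c :: real
  assume u: "u \<in> {u. bounded (range u)}"
  show "(\<lambda>x. c * u x) \<in> {u. bounded (range u)}"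
    using bounded_scaling[of "range u" c] u by (simp add: image_image)
  assume w: "w \<in> {u. bounded (range u)}"
  show "(\<lambda>x. u x + w x) \<in> {u. bounded (range u)}"
    using u w by (simp add: bounded_plus_comp)
qed simp

section \<open>Preliminaries\<close>

lemma supn_le: "(\<And>x. cmod (f x) \<le> c) \<Longrightarrow> supn f \<le> c"
  unfolding supn_def by (intro cSUP_least) auto

lemma supn_nonneg:
  assumes "\<And>x. cmod (f x) \<le> c"
  shows "0 \<le> supn f"
proof -
  have "cmod (f undefined) \<le> supn f"
    unfolding supn_def by (intro cSUP_upper bdd_aboveI2[of _ _ c] assms) simp
  then show ?thesis using norm_ge_zero order_trans by blast
qed

lemma c0_cmod_le_supn:
  assumes "x \<in> c0"
  shows "cmod (x n) \<le> supn x"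
proof -
  have "Bseq x" using assms convergent_imp_Bseq[of x] by (auto simp: c0_def convergent_def)
  then obtain K where "\<And>n. cmod (x n) \<le> K" by (auto simp: Bseq_def)
  then have "bdd_above (range (\<lambda>n. cmod (x n)))" by (rule bdd_aboveI2)
  then show ?thesis unfolding supn_def by (intro cSUP_upper) auto
qed

lemma bdd_linD:
  assumes "bdd_lin S S' F"
  shows "\<And>f. f \<in> S \<Longrightarrow> F f \<in> S'"
    and "\<And>f g. f \<in> S \<Longrightarrow> g \<in> S \<Longrightarrow> F (\<lambda>x. f x + g x) = (\<lambda>y. F f y + F g y)"
    and "\<And>c f. f \<in> S \<Longrightarrow> F (\<lambda>x. c * f x) = (\<lambda>y. c * F f y)"
    and "\<exists>C. \<forall>f\<in>S. supn (F f) \<le> C * supn f"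
  using assms unfolding bdd_lin_def by blast+

lemma ex_unimodular: "\<exists>c. cmod c = 1 \<and> c * z = of_real (cmod z)"
proof (cases "z = 0")
  case True
  then show ?thesis by (intro exI[of _ 1]) simp
next
  case False
  then show ?thesis
    using complex_norm_square[of z]
    by (intro exI[of _ "cnj z / of_real (cmod z)"]) (simp add: norm_divide field_simps power2_eq_square)
qed

lemma convex_combination_eq_one:
  fixes t a b :: real
  assumes "1 = t * a + (1 - t) * b" "a \<le> 1" "b \<le> 1" "0 < t" "t < 1"
  shows "a = 1" "b = 1"
proof -
  have "t * (1 - a) + (1 - t) * (1 - b) = 0" using assms(1) by (simp add: algebra_simps)
  moreover have "t * (1 - a) \<ge> 0" "(1 - t) * (1 - b) \<ge> 0" using assms by simp_all
  ultimately have "t * (1 - a) = 0 \<and> (1 - t) * (1 - b) = 0" using add_nonneg_eq_0_iff by blast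
  then show "a = 1" "b = 1" using assms by auto
qed

lemma finite_disjoint_neighbourhoods:
  fixes S :: "'a::t2_space set"
  assumes "finite S"
  obtains V where "\<And>s. s \<in> S \<Longrightarrow> open (V s) \<and> s \<in> V s"
    "\<And>s t x. s \<in> S \<Longrightarrow> t \<in> S \<Longrightarrow> s \<noteq> t \<Longrightarrow> x \<in> V s \<Longrightarrow> x \<notin> V t"
proof -
  have "\<exists>U. \<forall>s t :: 'a. s \<noteq> t \<longrightarrow>
      open (fst (U s t)) \<and> open (snd (U s t)) \<and> s \<in> fst (U s t) \<and> t \<in> snd (U s t) \<and>
      fst (U s t) \<inter> snd (U s t) = {}"
    by (intro choice allI) (metis hausdorff fst_conv snd_conv)
  then obtain U :: "'a \<Rightarrow> 'a \<Rightarrow> 'a set \<times> 'a set" where U: "\<And>s t. s \<noteq> t \<Longrightarrow> open (fst (U s t))"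
    "\<And>s t. s \<noteq> t \<Longrightarrow> open (snd (U s t))" "\<And>s t. s \<noteq> t \<Longrightarrow> s \<in> fst (U s t)"
    "\<And>s t. s \<noteq> t \<Longrightarrow> t \<in> snd (U s t)" "\<And>s t. s \<noteq> t \<Longrightarrow> fst (U s t) \<inter> snd (U s t) = {}"
    by blast
  \<comment> \<open>For distinct \<open>s\<close> and \<open>t\<close> in \<open>S\<close> the sets
    \<open>V s\<close> and \<open>V t\<close> lie in the two disjoint halves of
    \<open>U s t\<close>.\<close>
  define V where "V s = (\<Inter>t\<in>S - {s}. fst (U s t) \<inter> snd (U t s))" for s
  show thesis
  proof (rule that)
    show "open (V s) \<and> s \<in> V s" if "s \<in> S" for s
    proof
      show "open (V s)" unfolding V_def by (intro open_INT ballI open_Int finite_Diff assms U) auto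
      show "s \<in> V s" unfolding V_def by (intro INT_I IntI U) auto
    qed
    show "x \<notin> V t" if "s \<in> S" "t \<in> S" "s \<noteq> t" "x \<in> V s" for s t x
      using U(5)[OF that(3)] that unfolding V_def by blast
  qed
qed

section \<open>Approximate peak sets\<close>

locale compact_function_algebra =
  fixes A :: "('a::t2_space \<Rightarrow> complex) set"
  assumes compact: "compact (UNIV :: 'a set)"
    and algebra: "function_algebra A"
begin

section \<open>Closure properties and boundedness\<close>

lemma cont: "f \<in> A \<Longrightarrow> continuous_on S f"
  using algebra by (auto simp: function_algebra_def intro: continuous_on_subset)

lemma closed_imp_compact: "closed S \<Longrightarrow> compact (S :: 'a set)"
  using compact_Int_closed[OF compact, of S] by simp

lemma const_mem: "(\<lambda>x. c) \<in> A"
  using algebra by (simp add: function_algebra_def)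

lemma add_mem: "f \<in> A \<Longrightarrow> g \<in> A \<Longrightarrow> (\<lambda>x. f x + g x) \<in> A"
  using algebra by (simp add: function_algebra_def)

lemma mult_mem: "f \<in> A \<Longrightarrow> g \<in> A \<Longrightarrow> (\<lambda>x. f x * g x) \<in> A"
  using algebra by (simp add: function_algebra_def)

lemma scale_mem: "f \<in> A \<Longrightarrow> (\<lambda>x. c * f x) \<in> A"
  by (intro mult_mem const_mem)

lemma neg_mem: "f \<in> A \<Longrightarrow> (\<lambda>x. - f x) \<in> A"
  using scale_mem[of f "-1"] by simp

lemma diff_mem: "f \<in> A \<Longrightarrow> g \<in> A \<Longrightarrow> (\<lambda>x. f x - g x) \<in> A"
  using add_mem[OF _ neg_mem] by simp

lemma power_mem: "f \<in> A \<Longrightarrow> (\<lambda>x. f x ^ n) \<in> A"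
  by (induction n) (auto intro: const_mem mult_mem)

lemma sum_mem: "(\<And>i. i \<in> I \<Longrightarrow> f i \<in> A) \<Longrightarrow> (\<lambda>x. \<Sum>i\<in>I. f i x) \<in> A"
  by (induction I rule: infinite_finite_induct) (auto intro: const_mem add_mem)

lemma limit_mem:
  assumes "\<And>n. X n \<in> A" "continuous_on UNIV l" "(\<lambda>n. supn (\<lambda>x. X n x - l x)) \<longlonglongrightarrow> 0"
  shows "l \<in> A"
  using algebra assms unfolding function_algebra_def by blast

lemma separating: "x \<noteq> y \<Longrightarrow> \<exists>f\<in>A. f x \<noteq> f y"
  using algebra by (simp add: function_algebra_def)

lemmas mem_intros = const_mem add_mem mult_mem neg_mem diff_mem power_mem sum_mem

lemma bounded:
  assumes "f \<in> A"
  obtains M where "M > 0" "\<And>x. cmod (f x) \<le> M"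
proof -
  have "bounded (range f)"
    using compact_continuous_image[OF cont[OF assms] compact] by (rule compact_imp_bounded)
  then show thesis using that by (auto simp: bounded_pos)
qed

lemma cmod_le_supn:
  assumes "f \<in> A"
  shows "cmod (f x) \<le> supn f"
proof -
  obtain M where "\<And>x. cmod (f x) \<le> M" using bounded[OF assms] by blast
  then have "bdd_above (range (\<lambda>x. cmod (f x)))" by (intro bdd_aboveI2)
  then show ?thesis unfolding supn_def by (intro cSUP_upper) auto
qed

text \<open>A logarithmic form of approximate peaking: \<open>exp f\<close> has modulus at most 1,
  at most \<open>exp (-1)\<close> off \<open>V\<close> and at least \<open>exp (- e)\<close> on
  \<open>F\<close>. In this form functions are combined by addition.\<close>

definition peak_approximable :: "'a set \<Rightarrow> bool" where
  "peak_approximable F \<longleftrightarrow> (\<forall>V e. open V \<and> F \<subseteq> V \<and> e > 0 \<longrightarrow>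
     (\<exists>f\<in>A. (\<forall>x. Re (f x) \<le> 0) \<and> (\<forall>x. x \<notin> V \<longrightarrow> Re (f x) \<le> -1) \<and> (\<forall>x\<in>F. - e \<le> Re (f x))))"

lemma peak_approximableE:
  assumes "peak_approximable F" "open V" "F \<subseteq> V" "e > 0"
  obtains f where "f \<in> A" "\<And>x. Re (f x) \<le> 0" "\<And>x. x \<notin> V \<Longrightarrow> Re (f x) \<le> -1"
    "\<And>x. x \<in> F \<Longrightarrow> - e \<le> Re (f x)"
  using assms unfolding peak_approximable_def by metis

text \<open>The analogue of "a face of a face is a face": a multiple of \<open>g - m\<close> is
  nonpositive on \<open>F\<close> and singles out the maximum set there, and a large multiple of a
  function peaking on \<open>F\<close> suppresses it away from \<open>F\<close>.\<close>

lemma peak_approximable_argmax: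
  assumes F: "peak_approximable F" "closed F" and g: "g \<in> A" and m: "\<And>x. x \<in> F \<Longrightarrow> Re (g x) \<le> m"
  shows "peak_approximable {x \<in> F. Re (g x) = m}"
  unfolding peak_approximable_def
proof (intro allI impI)
  fix V :: "'a set" and e :: real
  assume "open V \<and> {x \<in> F. Re (g x) = m} \<subseteq> V \<and> e > 0"
  then have V: "open V" "\<And>x. x \<in> F \<Longrightarrow> Re (g x) = m \<Longrightarrow> x \<in> V" and e: "e > 0" by auto
  have "\<exists>d>0. \<forall>x\<in>F - V. Re (g x) \<le> m - d"
  proof (cases "F - V = {}")
    case True
    then show ?thesis by (auto intro: exI[of _ 1])
  next
    case False
    have "compact (F - V)"
      by (intro closed_imp_compact closed_Diff F V)
    then obtain x where x: "x \<in> F - V" "\<And>y. y \<in> F - V \<Longrightarrow> Re (g y) \<le> Re (g x)"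
      using continuous_attains_sup[of "F - V" "\<lambda>x. Re (g x)"] False
      by (auto intro!: continuous_intros cont g)
    have "Re (g x) < m" using m[of x] V(2)[of x] x by force
    then show ?thesis using x(2) by (intro exI[of _ "m - Re (g x)"]) auto
  qed
  then obtain d where d: "d > 0" "\<And>x. x \<in> F \<Longrightarrow> x \<notin> V \<Longrightarrow> Re (g x) \<le> m - d" by blast
  \<comment> \<open>The factor \<open>2 / d\<close> brings \<open>Re g'\<close> to at most -2 on
    \<open>F - V\<close>, while it is 0 where \<open>Re g = m\<close>.\<close>
  define g' where "g' = (\<lambda>x. of_real (2 / d) * (g x - of_real m))"
  have g': "g' \<in> A" unfolding g'_def by (intro mem_intros g)
  have Re_g': "Re (g' x) = (2 / d) * (Re (g x) - m)" for x by (simp add: g'_def)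
  have cont_g': "continuous_on UNIV (\<lambda>x. Re (g' x))" by (intro continuous_intros cont g')
  \<comment> \<open>A neighbourhood of \<open>F\<close> where \<open>g'\<close> has the required
    bounds up to \<open>e / 2\<close>; points off \<open>W\<close> are left to
    \<open>f\<close>.\<close>
  define W where "W = {x. Re (g' x) < e / 2} \<inter> ({x. Re (g' x) < -1} \<union> V)"
  have "open W" unfolding W_def
    by (intro open_Int open_Un V open_Collect_less continuous_on_const cont_g')
  moreover have "F \<subseteq> W"
  proof
    fix x assume x: "x \<in> F"
    have "Re (g' x) \<le> 0" using m[OF x] d(1) by (simp add: Re_g' divide_nonpos_pos)
    moreover have "Re (g' x) < -1" if "x \<notin> V"
      using d(2)[OF x that] d(1) by (simp add: Re_g' field_simps)
    ultimately show "x \<in> W" using e by (auto simp: W_def)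
  qed
  moreover obtain M where M: "M > 0" "\<And>x. cmod (g' x) \<le> M" using bounded[OF g'] by blast
  \<comment> \<open>Now \<open>(M + 1) e' = e / 2\<close> is half of the permitted loss on the
    maximum set; the constant \<open>e / 2\<close> subtracted in \<open>r\<close> is the other
    half.\<close>
  moreover define e' where "e' = e / (2 * (M + 1))"
  moreover have "e' > 0" using e M(1) by (simp add: e'_def)
  ultimately obtain f where f: "f \<in> A" "\<And>x. Re (f x) \<le> 0" "\<And>x. x \<notin> W \<Longrightarrow> Re (f x) \<le> -1"
    "\<And>x. x \<in> F \<Longrightarrow> - e' \<le> Re (f x)"
    using F(1) by (metis peak_approximableE)
  define r where "r = (\<lambda>x. g' x + of_real (M + 1) * f x - of_real (e / 2))"
  have Re_r: "Re (r x) = Re (g' x) + (M + 1) * Re (f x) - e / 2" for x by (simp add: r_def)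
  have Mf: "(M + 1) * Re (f x) \<le> 0" for x using f(2)[of x] M(1) by (simp add: mult_nonneg_nonpos)
  have out: "Re (r x) \<le> -1" if "x \<notin> W" for x
  proof -
    have "(M + 1) * Re (f x) \<le> (M + 1) * (-1)"
      using f(3)[OF that] M(1) by (intro mult_left_mono) auto
    then show ?thesis using M(2)[of x] complex_Re_le_cmod[of "g' x"] e by (simp add: Re_r)
  qed
  show "\<exists>f\<in>A. (\<forall>x. Re (f x) \<le> 0) \<and> (\<forall>x. x \<notin> V \<longrightarrow> Re (f x) \<le> -1) \<and>
      (\<forall>x\<in>{x \<in> F. Re (g x) = m}. - e \<le> Re (f x))"
  proof (intro bexI conjI allI impI ballI)
    show "r \<in> A" unfolding r_def by (intro mem_intros g' f)
    show "Re (r x) \<le> 0" for x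
      using out[of x] Mf[of x] by (cases "x \<in> W") (auto simp: Re_r W_def)
    show "Re (r x) \<le> -1" if "x \<notin> V" for x
      using out[of x] Mf[of x] that e by (cases "x \<in> W") (auto simp: Re_r W_def)
    show "- e \<le> Re (r x)" if "x \<in> {x \<in> F. Re (g x) = m}" for x
    proof -
      have "(M + 1) * (- e') \<le> (M + 1) * Re (f x)"
        using f(4)[of x] that M(1) by (intro mult_left_mono) auto
      moreover have "(M + 1) * (- e') = - e / 2" using M(1) by (simp add: e'_def field_simps)
      moreover have "Re (g' x) = 0" using that by (simp add: Re_g')
      ultimately show ?thesis by (simp add: Re_r)
    qed
  qed
qed

text \<open>By compactness an open set containing the intersection of the complements already
  contains the complement of one member of the chain. With the empty open set this shows that a
  chain of proper subsets has a proper union.\<close>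

lemma peak_approximable_chain:
  assumes "\<C> \<noteq> {}" "subset.chain {U. open U \<and> peak_approximable (- U)} \<C>"
  shows "peak_approximable (- \<Union>\<C>)"
    and "\<Union>\<C> = UNIV \<Longrightarrow> UNIV \<in> \<C>"
proof -
  have *: "\<exists>U\<in>\<C>. - U \<subseteq> V" if V: "open V" "- \<Union>\<C> \<subseteq> V" for V
  proof -
    have "UNIV \<subseteq> \<Union>(insert V \<C>)" using V(2) by auto
    moreover have "\<And>B. B \<in> insert V \<C> \<Longrightarrow> open B" 
      using V assms(2) by (auto simp: subset.chain_def)
    ultimately obtain D where D: "D \<subseteq> insert V \<C>" "finite D" "UNIV \<subseteq> \<Union>D"
      using compactE[OF compact] by metis
    have ch: "X \<subseteq> Y \<or> Y \<subseteq> X" if "X \<in> \<C>" "Y \<in> \<C>" for X Y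
      using that assms(2) by (auto simp: subset.chain_def)
    have "\<exists>U\<in>\<C>. \<Union>E \<subseteq> U" if "finite E" "E \<subseteq> \<C>" for E
      using that
    proof (induction E)
      case empty
      then show ?case using assms(1) by auto
    next
      case (insert X E)
      then obtain U where U: "U \<in> \<C>" "\<Union>E \<subseteq> U" by auto
      then consider "X \<subseteq> U" | "U \<subseteq> X" using ch[of X U] insert.prems by blast
      then show ?case
      proof cases
        case 1
        then have "\<Union>(insert X E) \<subseteq> U" using U(2) by simp
        then show ?thesis using U(1) by blast
      next
        case 2
        then have "\<Union>(insert X E) \<subseteq> X" using U(2) by auto
        then show ?thesis using insert.prems by blast
      qed
    qed
    from this[of "D - {V}"] obtain U where "U \<in> \<C>" "\<Union>(D - {V}) \<subseteq> U" using D by blast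
    then show ?thesis using D(3) by blast
  qed
  show "peak_approximable (- \<Union>\<C>)"
    unfolding peak_approximable_def
  proof (intro allI impI)
    fix V :: "'a set" and e :: real
    assume V: "open V \<and> - \<Union>\<C> \<subseteq> V \<and> e > 0"
    then obtain U where U: "U \<in> \<C>" "- U \<subseteq> V" using * by blast
    then have "peak_approximable (- U)" using assms(2) by (auto simp: subset.chain_def)
    then obtain f where "f \<in> A" "\<And>x. Re (f x) \<le> 0" "\<And>x. x \<notin> V \<Longrightarrow> Re (f x) \<le> -1"
      "\<And>x. x \<in> - U \<Longrightarrow> - e \<le> Re (f x)"
      using V U(2) by (metis peak_approximableE)
    then show "\<exists>f\<in>A. (\<forall>x. Re (f x) \<le> 0) \<and> (\<forall>x. x \<notin> V \<longrightarrow> Re (f x) \<le> -1) \<and>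
      (\<forall>x\<in>- \<Union>\<C>. - e \<le> Re (f x))"
      using U(1) by (intro bexI[of _ f]) auto
  qed
  show "UNIV \<in> \<C>" if C: "\<Union>\<C> = UNIV"
  proof -
    obtain U where U: "U \<in> \<C>" "- U \<subseteq> {}" using *[of "{}"] C by auto
    then have "U = UNIV" by blast
    then show ?thesis using U(1) by simp
  qed
qed

text \<open>Zorn's lemma gives a minimal nonempty closed peak approximable subset (as the complement
  of a maximal open set). On it every \<open>Re g\<close> is constant, as otherwise the maximum set
  would be smaller. Using \<open>f\<close> and \<open>- \<i> * f\<close>, and since \<open>A\<close>
  separates points, it is a singleton.\<close>

lemma ex_peak_approximable_point:
  assumes F: "peak_approximable F" "closed F" "F \<noteq> {}"
  shows "\<exists>k\<in>F. peak_approximable {k}"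
proof -
  define \<U> where "\<U> = {U. open U \<and> U \<noteq> UNIV \<and> - F \<subseteq> U \<and> peak_approximable (- U)}"
  have "\<exists>M\<in>\<U>. \<forall>X\<in>\<U>. M \<subseteq> X \<longrightarrow> X = M"
  proof (rule subset_Zorn_nonempty)
    show "\<U> \<noteq> {}" using F by (auto simp: \<U>_def intro!: exI[of _ "- F"])
    fix \<C> assume C: "\<C> \<noteq> {}" "subset.chain \<U> \<C>"
    then have "subset.chain {U. open U \<and> peak_approximable (- U)} \<C>"
      by (auto simp: subset.chain_def \<U>_def)
    note chain = peak_approximable_chain[OF C(1) this]
    show "\<Union>\<C> \<in> \<U>"
      using C chain unfolding \<U>_def subset.chain_def by blast
  qed
  then obtain M where M: "M \<in> \<U>" and max: "\<And>X. X \<in> \<U> \<Longrightarrow> M \<subseteq> X \<Longrightarrow> X = M" by blast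
  have cl: "closed (- M)" and pa: "peak_approximable (- M)" and ne: "- M \<noteq> {}" and sub: "- M \<subseteq> F"
    using M by (auto simp: \<U>_def)
  have const: "Re (g x) = Re (g y)" if g: "g \<in> A" and x: "x \<notin> M" and y: "y \<notin> M" for g x y
  proof -
    have "compact (- M)" by (rule closed_imp_compact[OF cl])
    then obtain z where z: "z \<in> - M" "\<And>y. y \<in> - M \<Longrightarrow> Re (g y) \<le> Re (g z)"
      using continuous_attains_sup[of "- M" "\<lambda>x. Re (g x)"] ne
      by (auto intro!: continuous_intros cont g)
    define X where "X = - {x \<in> - M. Re (g x) = Re (g z)}"
    have "closed (- M \<inter> {x. Re (g x) = Re (g z)})"
      by (intro closed_Int cl closed_Collect_eq continuous_intros cont g)
    moreover have "- M \<inter> {x. Re (g x) = Re (g z)} = {x \<in> - M. Re (g x) = Re (g z)}" by auto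
    ultimately have "closed {x \<in> - M. Re (g x) = Re (g z)}" by simp
    moreover have "peak_approximable (- X)"
      unfolding X_def double_complement by (rule peak_approximable_argmax[OF pa cl g z(2)])
    ultimately have "X \<in> \<U>" using sub z(1) by (auto simp: \<U>_def X_def)
    moreover have "M \<subseteq> X" by (auto simp: X_def)
    ultimately have "X = M" by (rule max)
    then have "x \<notin> X" "y \<notin> X" using x y by simp_all
    then show ?thesis unfolding X_def by simp
  qed
  obtain k where k: "k \<notin> M" using ne by auto
  have "x = k" if x: "x \<notin> M" for x
  proof (rule ccontr)
    assume "x \<noteq> k"
    then obtain f where f: "f \<in> A" "f x \<noteq> f k" using separating by blast
    have "Re (f x) = Re (f k)" by (rule const[OF f(1) x k])
    moreover have "Re (- \<i> * f x) = Re (- \<i> * f k)"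
      by (rule const[OF _ x k]) (intro mem_intros f)
    ultimately show False using f(2) by (simp add: complex_eq_iff)
  qed
  then have "- M = {k}" using k by blast
  then show ?thesis using pa sub by (metis insertI1 subsetD)
qed

text \<open>The whole space is peak approximable by means of the constant 0, hence so is the maximum
  set of \<open>Re g\<close>.\<close>

lemma ex_argmax_peak_approximable:
  assumes g: "g \<in> A"
  obtains k where "peak_approximable {k}" "\<And>x. Re (g x) \<le> Re (g k)"
proof -
  obtain z where z: "\<And>y. Re (g y) \<le> Re (g z)"
    using continuous_attains_sup[of UNIV "\<lambda>x. Re (g x)"] compact
    by (auto intro!: continuous_intros cont g)
  have "peak_approximable UNIV"
    by (auto simp: peak_approximable_def intro!: bexI[OF _ const_mem[of 0]])
  then have "peak_approximable {x \<in> UNIV. Re (g x) = Re (g z)}"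
    by (rule peak_approximable_argmax) (use g z in auto)
  moreover have "closed {x \<in> UNIV. Re (g x) = Re (g z)}"
    by (auto intro!: closed_Collect_eq continuous_intros cont g)
  ultimately obtain k where "Re (g k) = Re (g z)" "peak_approximable {k}"
    using ex_peak_approximable_point by fastforce
  then show thesis using that z by metis
qed

section \<open>Functionals in the dual ball\<close>

lemma dual_add: "\<phi> \<in> dual_space A \<Longrightarrow> f \<in> A \<Longrightarrow> g \<in> A \<Longrightarrow> \<phi> (\<lambda>x. f x + g x) = \<phi> f + \<phi> g"
  unfolding dual_space_def by blast

lemma dual_scale: "\<phi> \<in> dual_space A \<Longrightarrow> f \<in> A \<Longrightarrow> \<phi> (\<lambda>x. c * f x) = c * \<phi> f"
  unfolding dual_space_def by blast

lemma dual_ball_le: "\<phi> \<in> dual_ball A \<Longrightarrow> f \<in> A \<Longrightarrow> cmod (\<phi> f) \<le> supn f"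
  unfolding dual_ball_def by blast

text \<open>For large \<open>c\<close> the norm of \<open>c + f\<close> exceeds \<open>c\<close> by
  a term of order \<open>1 / c\<close> only, whereas \<open>Re (\<phi> f) > 0\<close> would make the
  value of \<open>\<phi>\<close> exceed \<open>c\<close> by a fixed amount.\<close>

lemma state_mono:
  assumes phi: "\<phi> \<in> dual_ball A" "\<phi> (\<lambda>x. 1) = 1" and f: "f \<in> A" "\<And>x. Re (f x) \<le> 0"
  shows "Re (\<phi> f) \<le> 0"
proof (rule ccontr)
  assume "\<not> Re (\<phi> f) \<le> 0"
  then have r: "Re (\<phi> f) > 0" by simp
  have dual: "\<phi> \<in> dual_space A" using phi(1) by (simp add: dual_ball_def)
  obtain M where M: "M > 0" "\<And>x. cmod (f x) \<le> M" using bounded[OF f(1)] by blast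
  \<comment> \<open>Makes the cross term \<open>2 c Re (\<phi> f)\<close> equal to
    \<open>2 M\<^sup>2\<close>, where only \<open>M\<^sup>2\<close> is allowed.\<close>
  define c where "c = M\<^sup>2 / Re (\<phi> f)"
  have c: "c > 0" using M r by (simp add: c_def)
  have "cmod (of_real c + f x) \<le> sqrt (c\<^sup>2 + M\<^sup>2)" for x
  proof -
    have "(cmod (of_real c + f x))\<^sup>2 = c\<^sup>2 + 2 * c * Re (f x) + (cmod (f x))\<^sup>2"
      unfolding cmod_power2 by (simp add: power2_eq_square algebra_simps)
    also have "\<dots> \<le> c\<^sup>2 + M\<^sup>2"
      using mult_nonneg_nonpos[of "2 * c", OF _ f(2)[of x]] c power_mono[OF M(2)[of x], of 2] by simp
    finally show ?thesis by (rule real_le_rsqrt)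
  qed
  then have "supn (\<lambda>x. of_real c + f x) \<le> sqrt (c\<^sup>2 + M\<^sup>2)" by (rule supn_le)
  moreover have "\<phi> (\<lambda>x. of_real c + f x) = of_real c + \<phi> f"
    using dual_add[OF dual const_mem f(1), of "of_real c"] dual_scale[OF dual const_mem[of 1], of "of_real c"]
      phi(2) by simp
  moreover have "cmod (\<phi> (\<lambda>x. of_real c + f x)) \<le> supn (\<lambda>x. of_real c + f x)"
    by (rule dual_ball_le[OF phi(1)]) (intro mem_intros f)
  moreover have "c + Re (\<phi> f) \<le> cmod (of_real c + \<phi> f)"
    using complex_Re_le_cmod[of "of_real c + \<phi> f"] by simp
  ultimately have "c + Re (\<phi> f) \<le> sqrt (c\<^sup>2 + M\<^sup>2)" by simp
  then have "(c + Re (\<phi> f))\<^sup>2 \<le> c\<^sup>2 + M\<^sup>2"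
    using c r by (simp add: sqrt_ge_absD)
  then have "2 * c * Re (\<phi> f) + (Re (\<phi> f))\<^sup>2 \<le> M\<^sup>2" by (simp add: power2_sum)
  then have "2 * M\<^sup>2 + (Re (\<phi> f))\<^sup>2 \<le> M\<^sup>2" using r by (simp add: c_def)
  moreover have "(Re (\<phi> f))\<^sup>2 > 0" "M\<^sup>2 > 0" using r M by auto
  ultimately show False by simp
qed

section \<open>The Choquet boundary consists of the approximate peak points\<close>

lemma eval_dual_ball: "(\<lambda>f. f k) \<in> dual_ball A"
  unfolding dual_ball_def dual_space_def using cmod_le_supn by (auto intro!: exI[of _ 1])

text \<open>In a convex splitting of the evaluation at \<open>k\<close> both functionals take the
  value 1 at the constant 1 and are therefore positive. Their values at a function peaking at
  \<open>k\<close> average to nearly 0 in real part and are nonpositive, so both are nearly 0: the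
  functionals are concentrated at \<open>k\<close>.\<close>

lemma peak_approximable_imp_choquet:
  assumes k: "peak_approximable {k}"
  shows "k \<in> choquet_boundary A"
  unfolding choquet_boundary_def extreme_in_dual_ball_def mem_Collect_eq
proof (intro conjI ballI allI impI)
  show "(\<lambda>f. f k) \<in> dual_ball A" by (rule eval_dual_ball)
  have main: "\<phi>1 f = f k"
    if phi: "\<phi>1 \<in> dual_ball A" "\<phi>2 \<in> dual_ball A" and t: "0 < t" "t < 1"
      and eq: "\<And>f. f \<in> A \<Longrightarrow> f k = of_real t * \<phi>1 f + of_real (1 - t) * \<phi>2 f" and f: "f \<in> A"
    for \<phi>1 \<phi>2 t f
  proof -
    have dual: "\<phi>1 \<in> dual_space A" using phi(1) by (simp add: dual_ball_def)
    have norm1: "cmod (\<phi> (\<lambda>x. 1)) \<le> 1" if "\<phi> \<in> dual_ball A" for \<phi>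
      using dual_ball_le[OF that const_mem[of 1]] supn_le[of "\<lambda>x::'a. 1" 1] by force
    have sum1: "1 = t * Re (\<phi>1 (\<lambda>x. 1)) + (1 - t) * Re (\<phi>2 (\<lambda>x. 1))"
      using arg_cong[OF eq[OF const_mem[of 1]], of Re] by simp
    have le1: "Re (\<phi>1 (\<lambda>x. 1)) \<le> 1" "Re (\<phi>2 (\<lambda>x. 1)) \<le> 1"
      using norm1[OF phi(1)] norm1[OF phi(2)] complex_Re_le_cmod order_trans by blast+
    have re1: "Re (\<phi>1 (\<lambda>x. 1)) = 1" "Re (\<phi>2 (\<lambda>x. 1)) = 1"
      by (rule convex_combination_eq_one[OF sum1 le1 t])+
    have one: "z = 1" if "Re z = 1" "cmod z \<le> 1" for z
    proof -
      have "(cmod z)\<^sup>2 \<le> 1" using that(2) by (simp add: power_le_one)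
      then show ?thesis using that(1) by (simp add: cmod_power2 complex_eq_iff)
    qed
    have unit: "\<phi>1 (\<lambda>x. 1) = 1" "\<phi>2 (\<lambda>x. 1) = 1"
      using one re1 norm1[OF phi(1)] norm1[OF phi(2)] by auto
    have le0: "Re (\<phi>1 g) \<le> 0" if g: "g \<in> A" "g k = 0" for g
    proof (rule field_le_epsilon)
      fix e :: real assume e: "e > 0"
      obtain M where M: "M > 0" "\<And>x. cmod (g x) \<le> M" using bounded[OF g(1)] by blast
      define V where "V = {x. Re (g x) < e / 2}"
      have V: "open V" unfolding V_def
        by (intro open_Collect_less continuous_intros cont g)
      have kV: "{k} \<subseteq> V" using g(2) e by (simp add: V_def)
      \<comment> \<open>Since \<open>Re (\<phi>1 h) \<ge> - d / t\<close>, the term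
        \<open>M h\<close> in \<open>r\<close> costs at most \<open>e / 2\<close>.\<close>
      define d where "d = e * t / (2 * M)"
      have "d > 0" using e t M by (simp add: d_def)
      then obtain h where h: "h \<in> A" "\<And>x. Re (h x) \<le> 0" "\<And>x. x \<notin> V \<Longrightarrow> Re (h x) \<le> -1"
        "\<And>x. x \<in> {k} \<Longrightarrow> - d \<le> Re (h x)"
        using peak_approximableE[OF k V kV] by blast
      define r where "r = (\<lambda>x. g x + (of_real M * h x + of_real (- e / 2) * 1))"
      have r_le: "Re (\<phi>1 r) \<le> 0"
      proof (rule state_mono[OF phi(1) unit(1)])
        show "r \<in> A" unfolding r_def by (intro mem_intros g h)
        show "Re (r x) \<le> 0" for x
        proof (cases "x \<in> V")
          case True
          then show ?thesis using mult_nonneg_nonpos[OF less_imp_le[OF M(1)] h(2)[of x]]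
            by (simp add: r_def V_def)
        next
          case False
          have "M * Re (h x) \<le> M * (-1)" using M(1) h(3)[OF False] by (intro mult_left_mono) auto
          then show ?thesis using M(2)[of x] complex_Re_le_cmod[of "g x"] e by (simp add: r_def)
        qed
      qed
      have r_eq: "\<phi>1 r = \<phi>1 g + (of_real M * \<phi>1 h + of_real (- e / 2) * \<phi>1 (\<lambda>x. 1))"
        unfolding r_def
        by (simp only: dual_add[OF dual g(1) add_mem[OF scale_mem[OF h(1)] scale_mem[OF const_mem[of 1]]]]
            dual_add[OF dual scale_mem[OF h(1)] scale_mem[OF const_mem[of 1]]]
            dual_scale[OF dual h(1)] dual_scale[OF dual const_mem[of 1]])
      have "- (d / t) \<le> Re (\<phi>1 h)"
      proof -
        have "Re (h k) = t * Re (\<phi>1 h) + (1 - t) * Re (\<phi>2 h)"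
          using arg_cong[OF eq[OF h(1)], of Re] by simp
        moreover have "(1 - t) * Re (\<phi>2 h) \<le> 0"
          using state_mono[OF phi(2) unit(2) h(1,2)] t by (simp add: mult_nonneg_nonpos)
        ultimately have "- d \<le> t * Re (\<phi>1 h)" using h(4)[of k] by simp
        then show ?thesis using t by (simp add: field_simps)
      qed
      then have "M * (- (d / t)) \<le> M * Re (\<phi>1 h)" using M(1) by (intro mult_left_mono) auto
      moreover have "M * (- (d / t)) = - e / 2" using M(1) t by (simp add: d_def)
      ultimately have "- e / 2 \<le> M * Re (\<phi>1 h)" by linarith
      then show "Re (\<phi>1 g) \<le> 0 + e" using r_le r_eq unit(1) by simp
    qed
    define g where "g = (\<lambda>x. f x + of_real (-1) * f k * 1)"
    have g: "g \<in> A" "g k = 0" unfolding g_def by (intro mem_intros f) simp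
    have "Re (c * \<phi>1 g) \<le> 0" for c
      using le0[of "\<lambda>x. c * g x"] g dual_scale[OF dual g(1), of c] by (simp add: scale_mem)
    \<comment> \<open>The conjugate turns the bound on real parts into
      \<open>(cmod (\<phi>1 g))\<^sup>2 \<le> 0\<close>.\<close>
    from this[of "cnj (\<phi>1 g)"] have "\<phi>1 g = 0"
      by (simp add: complex_eq_iff) (metis add_nonneg_nonneg add_nonneg_eq_0_iff antisym mult_eq_0_iff zero_le_square)
    moreover have "\<phi>1 g = \<phi>1 f + of_real (-1) * f k * \<phi>1 (\<lambda>x. 1)"
      unfolding g_def using dual_add[OF dual f scale_mem[OF const_mem[of 1]], of "of_real (-1) * f k"]
        dual_scale[OF dual const_mem[of 1], of "of_real (-1) * f k"] by simp
    ultimately show "\<phi>1 f = f k" using unit(1) by simp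
  qed
  fix \<phi>1 \<phi>2 t f
  assume phi: "\<phi>1 \<in> dual_ball A" "\<phi>2 \<in> dual_ball A"
    and t: "0 < t \<and> t < 1 \<and> (\<forall>f\<in>A. f k = of_real t * \<phi>1 f + of_real (1 - t) * \<phi>2 f)"
    and f: "f \<in> A"
  have "\<phi>1 f = f k" using main[OF phi, of t f] t f by blast
  moreover have "\<phi>2 f = f k"
    using main[OF phi(2,1), of "1 - t" f] t f by (auto simp: add.commute)
  ultimately show "\<phi>1 f = \<phi>2 f" by simp
qed

text \<open>A linear functional on the bounded functions below this one is positive and reproduces
  \<open>Re (f k)\<close> for \<open>f\<close> in \<open>A\<close>. Hahn-Banach thus supplies
  finitely additive representing measures.\<close>

definition upper_envelope :: "'a \<Rightarrow> ('a \<Rightarrow> real) \<Rightarrow> real" where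
  "upper_envelope k u = Inf {Re (f k) | f. f \<in> A \<and> (\<forall>x. u x \<le> Re (f x))}"

lemma upper_envelope_le:
  assumes "f \<in> A" "\<And>x. u x \<le> Re (f x)"
  shows "upper_envelope k u \<le> Re (f k)"
  unfolding upper_envelope_def
  by (rule cInf_lower) (use assms in \<open>auto intro!: bdd_belowI[of _ "u k"]\<close>)

lemma upper_envelope_greatest:
  assumes "bounded (range u)" "\<And>f. f \<in> A \<Longrightarrow> \<forall>x. u x \<le> Re (f x) \<Longrightarrow> c \<le> Re (f k)"
  shows "c \<le> upper_envelope k u"
proof -
  obtain M where "\<And>x. \<bar>u x\<bar> \<le> M" using assms(1) by (auto simp: bounded_iff)
  then have "\<forall>x. u x \<le> Re (of_real M)" by (metis Re_complex_of_real abs_le_D1)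
  then have "\<exists>f\<in>A. \<forall>x. u x \<le> Re (f x)" by (rule bexI[OF _ const_mem])
  then show ?thesis unfolding upper_envelope_def
    by (intro cInf_greatest) (use assms(2) in auto)
qed

lemma sublinear_upper_envelope: "sublinear_on {u. bounded (range u)} (upper_envelope k)"
  unfolding sublinear_on_def
proof (intro conjI ballI allI impI)
  interpret B: real_function_space "{u :: 'a \<Rightarrow> real. bounded (range u)}"
    by (rule bounded_real_function_space)
  let ?p = "upper_envelope k"
  {
    fix u w :: "'a \<Rightarrow> real"
    assume u: "u \<in> {u. bounded (range u)}" and w: "w \<in> {u. bounded (range u)}"
    have key: "?p (\<lambda>x. u x + w x) \<le> Re (f k) + Re (g k)"
      if "f \<in> A" "\<forall>x. u x \<le> Re (f x)" "g \<in> A" "\<forall>x. w x \<le> Re (g x)" for f g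
      using upper_envelope_le[of "\<lambda>x. f x + g x" "\<lambda>x. u x + w x" k] that
      by (simp add: add_mem add_mono)
    have "?p (\<lambda>x. u x + w x) - Re (g k) \<le> ?p u" if "g \<in> A" "\<forall>x. w x \<le> Re (g x)" for g
      by (rule upper_envelope_greatest) (use u key that in \<open>auto simp: algebra_simps\<close>)
    then have "?p (\<lambda>x. u x + w x) - ?p u \<le> ?p w"
      by (intro upper_envelope_greatest) (use w in \<open>auto simp: algebra_simps\<close>)
    then show "?p (\<lambda>x. u x + w x) \<le> ?p u + ?p w" by simp
  next
    have le: "?p (\<lambda>x. c * u x) \<le> c * ?p u" if u: "bounded (range u)" and c: "c > 0" for u c
    proof -
      have "?p (\<lambda>x. c * u x) / c \<le> Re (f k)" if "f \<in> A" "\<forall>x. u x \<le> Re (f x)" for f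
        using upper_envelope_le[of "\<lambda>x. of_real c * f x" "\<lambda>x. c * u x" k] that c
        by (simp add: scale_mem field_simps)
      then have "?p (\<lambda>x. c * u x) / c \<le> ?p u" by (rule upper_envelope_greatest[OF u])
      then show ?thesis using c by (simp add: field_simps)
    qed
    fix c :: real and u :: "'a \<Rightarrow> real"
    assume c: "c > 0" and u: "u \<in> {u. bounded (range u)}"
    have "?p (\<lambda>x. (1 / c) * (c * u x)) \<le> (1 / c) * ?p (\<lambda>x. c * u x)"
      by (rule le) (use c B.scale_mem[OF u] in auto)
    moreover have "(\<lambda>x. (1 / c) * (c * u x)) = u" using c by auto
    ultimately have "c * ?p u \<le> ?p (\<lambda>x. c * u x)" using c by (simp add: field_simps)
    with le[OF _ c] u show "?p (\<lambda>x. c * u x) = c * ?p u" by force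
  }
qed

text \<open>A linear functional below the envelope is a finitely additive probability representing
  the evaluation at \<open>k\<close>. Restricting it to a set and to the complement splits the evaluation into
  a convex combination, so extremality forces every restriction to be a multiple of it.\<close>
lemma choquet_imp_peak_approximable:
  assumes k: "k \<in> choquet_boundary A"
  shows "peak_approximable {k}"
  unfolding peak_approximable_def
proof (intro allI impI)
  fix U :: "'a set" and e :: real
  assume U: "open U \<and> {k} \<subseteq> U \<and> e > 0"
  interpret B: real_function_space "{u :: 'a \<Rightarrow> real. bounded (range u)}"
    by (rule bounded_real_function_space)
  have extremal: "\<forall>f\<in>A. \<phi>1 f = \<phi>2 f"
    if "\<phi>1 \<in> dual_ball A" "\<phi>2 \<in> dual_ball A" "0 < t" "t < 1"
      "\<forall>f\<in>A. f k = of_real t * \<phi>1 f + of_real (1 - t) * \<phi>2 f" for \<phi>1 \<phi>2 t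
    using k that unfolding choquet_boundary_def extreme_in_dual_ball_def by blast
  define BF where "BF = {u :: 'a \<Rightarrow> real. bounded (range u)}"
  define ind :: "'a set \<Rightarrow> 'a \<Rightarrow> real" where "ind = indicator"
  have ind_BF: "ind N \<in> BF" for N
    unfolding BF_def ind_def by (auto simp: bounded_iff indicator_def intro!: exI[of _ 1])
  \<comment> \<open>\<open>L\<close> attains the envelope at the indicator of \<open>- U\<close>.
    Once \<open>- U\<close> is seen to have mass 0, the envelope vanishes there, and a majorant in
    \<open>A\<close> that is small at \<open>k\<close> yields the peaking function.\<close>
  obtain L where Lp: "\<And>u. u \<in> BF \<Longrightarrow> L u \<le> upper_envelope k u"
    and Lv: "L (ind (- U)) = upper_envelope k (ind (- U))"
    and Ladd: "\<And>u w. u \<in> BF \<Longrightarrow> w \<in> BF \<Longrightarrow> L (\<lambda>x. u x + w x) = L u + L w"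
    and Lscale: "\<And>c u. u \<in> BF \<Longrightarrow> L (\<lambda>x. c * u x) = c * L u"
    using B.Hahn_Banach[OF sublinear_upper_envelope, of "ind (- U)" k] ind_BF unfolding BF_def by blast
  note BF_add = B.add_mem[folded BF_def] and BF_scale = B.scale_mem[folded BF_def]
  have L_mono: "L u \<le> L w" if u: "u \<in> BF" and w: "w \<in> BF" and le: "\<And>x. u x \<le> w x" for u w
  proof -
    have "L (\<lambda>x. u x + (-1) * w x) \<le> Re 0"
      using Lp[OF BF_add[OF u BF_scale[OF w, of "-1"]]]
        upper_envelope_le[OF const_mem[of 0], of "\<lambda>x. u x + (-1) * w x" k] le by force
    then show ?thesis using Ladd[OF u BF_scale[OF w, of "-1"]] Lscale[OF w, of "-1"] by simp
  qed
  have Re_BF: "(\<lambda>x. ind N x * Re (f x)) \<in> BF" if f: "f \<in> A" for N f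
  proof -
    obtain M where M: "\<And>x. cmod (f x) \<le> M" "M > 0" using bounded[OF f] by blast
    have "\<bar>ind N x * Re (f x)\<bar> \<le> M" for x
      using M(2) M(1)[of x] abs_Re_le_cmod[of "f x"] by (auto simp: ind_def indicator_def)
    then show ?thesis by (auto simp: BF_def bounded_iff)
  qed
  have L_Re_le: "L (\<lambda>x. Re (f x)) \<le> Re (f k)" if "f \<in> A" for f
    using Lp[of "\<lambda>x. Re (f x)"] upper_envelope_le[OF that, of "\<lambda>x. Re (f x)" k] Re_BF[OF that, of UNIV]
    by (simp add: ind_def)
  have L_Re: "L (\<lambda>x. Re (f x)) = Re (f k)" if "f \<in> A" for f
    using L_Re_le[OF that] L_Re_le[OF neg_mem[OF that]] Re_BF[OF that, of UNIV]
      Lscale[of "\<lambda>x. Re (f x)" "-1"] by (simp add: ind_def)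
  define m where "m N = L (ind N)" for N
  have m_mono: "m N \<le> m N'" if "N \<subseteq> N'" for N N'
    unfolding m_def by (rule L_mono[OF ind_BF ind_BF]) (use that in \<open>auto simp: ind_def indicator_def\<close>)
  have L0: "L (\<lambda>x. 0) = 0" using Lscale[OF ind_BF, of 0] by simp
  have "ind {} = (\<lambda>x. 0)" by (auto simp: ind_def)
  then have m_empty: "m {} = 0" using L0 by (simp add: m_def)
  then have m0: "m N \<ge> 0" for N using m_mono[of "{}" N] by simp
  have m1: "m N + m (- N) = 1" for N
  proof -
    have "(\<lambda>x. ind N x + ind (- N) x) = (\<lambda>x. Re 1)" by (auto simp: ind_def indicator_def)
    then show ?thesis using Ladd[OF ind_BF[of N] ind_BF[of "- N"]] L_Re[OF const_mem[of 1]]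
      by (simp add: m_def)
  qed
  have m_Un: "m (N \<union> N') \<le> m N + m N'" for N N'
  proof -
    have "m (N \<union> N') \<le> L (\<lambda>x. ind N x + ind N' x)"
      unfolding m_def by (intro L_mono ind_BF BF_add) (auto simp: ind_def indicator_def)
    then show ?thesis using Ladd[OF ind_BF[of N] ind_BF[of N']] by (simp add: m_def)
  qed
  define R where "R N f = L (\<lambda>x. ind N x * Re (f x))" for N f
  \<comment> \<open>The imaginary part comes from \<open>Re (- \<i> * f) = Im f\<close>.\<close>
  define \<phi> where "\<phi> N f = Complex (R N f) (R N (\<lambda>x. - \<i> * f x))" for N f
  have R_add: "R N (\<lambda>x. f x + g x) = R N f + R N g" if "f \<in> A" "g \<in> A" for N f g
    using Ladd[OF Re_BF[OF that(1), of N] Re_BF[OF that(2), of N]] by (simp add: R_def distrib_left)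
  have R_scale: "R N (\<lambda>x. of_real c * f x) = c * R N f" if "f \<in> A" for N f c
    using Lscale[OF Re_BF[OF that, of N], of c] by (simp add: R_def mult.left_commute)
  have R_le: "R N f \<le> m N * c" if "f \<in> A" "\<And>x. cmod (f x) \<le> c" for N f c
  proof -
    have "R N f \<le> L (\<lambda>x. c * ind N x)" unfolding R_def
    proof (rule L_mono[OF Re_BF[OF that(1)] BF_scale[OF ind_BF]])
      fix x
      show "ind N x * Re (f x) \<le> c * ind N x"
        using that(2)[of x] complex_Re_le_cmod[of "f x"] by (auto simp: ind_def indicator_def)
    qed
    then show ?thesis using Lscale[OF ind_BF[of N], of c] by (simp add: m_def mult.commute)
  qed
  have phi_add: "\<phi> N (\<lambda>x. f x + g x) = \<phi> N f + \<phi> N g" if "f \<in> A" "g \<in> A" for N f g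
    using R_add[OF that, of N] R_add[OF scale_mem[OF that(1), of "-\<i>"] scale_mem[OF that(2), of "-\<i>"], of N]
    by (simp add: \<phi>_def complex_eq_iff algebra_simps)
  have phi_scale: "\<phi> N (\<lambda>x. c * f x) = c * \<phi> N f" if f: "f \<in> A" for N f c
  proof -
    have *: "R N (\<lambda>x. z * f x) = Re z * R N f - Im z * R N (\<lambda>x. - \<i> * f x)" for z
    proof -
      have "(\<lambda>x. z * f x) = (\<lambda>x. of_real (Re z) * f x + of_real (- Im z) * (- \<i> * f x))"
        by (rule ext) (simp add: complex_eq_iff)
      then show ?thesis
        using R_add[of "\<lambda>x. of_real (Re z) * f x" "\<lambda>x. of_real (- Im z) * (- \<i> * f x)" N]
          R_scale[OF f, of N "Re z"] R_scale[OF scale_mem[OF f, of "-\<i>"], of N "- Im z"]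
          scale_mem[OF f] scale_mem[OF scale_mem[OF f]] by simp
    qed
    show ?thesis
      using *[of c] *[of "- \<i> * c"] by (simp add: \<phi>_def complex_eq_iff mult.assoc)
  qed
  have phi_le: "cmod (\<phi> N f) \<le> m N * c" if f: "f \<in> A" "\<And>x. cmod (f x) \<le> c" for N f c
  proof (cases "\<phi> N f = 0")
    case True
    have "0 \<le> c" using f(2) norm_ge_zero order_trans by blast
    then show ?thesis using True m0 by simp
  next
    case False
    define z where "z = cnj (\<phi> N f) / of_real (cmod (\<phi> N f))"
    have z: "cmod z = 1" using False by (simp add: z_def norm_divide)
    have "z * \<phi> N f = of_real (cmod (\<phi> N f))"
      using False complex_norm_square[of "\<phi> N f"] by (simp add: z_def field_simps power2_eq_square)
    then have "cmod (\<phi> N f) = Re (z * \<phi> N f)" by simp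
    also have "\<dots> = R N (\<lambda>x. z * f x)" using phi_scale[OF f(1), of N z] by (metis \<phi>_def complex.sel(1))
    also have "\<dots> \<le> m N * c" using f(2) z by (intro R_le scale_mem f) (simp add: norm_mult)
    finally show ?thesis .
  qed
  have R_sum: "R N f + R (- N) f = Re (f k)" if f: "f \<in> A" for N f
  proof -
    have "(\<lambda>x. ind N x * Re (f x) + ind (- N) x * Re (f x)) = (\<lambda>x. Re (f x))"
      by (auto simp: ind_def indicator_def)
    then show ?thesis
      using Ladd[OF Re_BF[OF f, of N] Re_BF[OF f, of "- N"]] L_Re[OF f] by (simp add: R_def)
  qed
  have phi_sum: "\<phi> N f + \<phi> (- N) f = f k" if f: "f \<in> A" for N f
    using R_sum[OF f, of N] R_sum[OF scale_mem[OF f, of "-\<i>"], of N] by (simp add: \<phi>_def complex_eq_iff)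
  have restr: "\<phi> N f = of_real (m N) * f k" if f: "f \<in> A" for N f
  proof -
    obtain M where M: "\<And>x. cmod (f x) \<le> M" using bounded[OF f] by blast
    consider "m N = 0" | "m (- N) = 0" | "0 < m N" "0 < m (- N)"
      using m0[of N] m0[of "- N"] by linarith
    then show ?thesis
    proof cases
      case 1
      then show ?thesis using phi_le[OF f M, of N] by simp
    next
      case 2
      then show ?thesis using phi_le[OF f M, of "- N"] phi_sum[OF f, of N] m1[of N] by simp
    next
      case 3
      have ball: "(\<lambda>f. \<phi> N f / of_real (m N)) \<in> dual_ball A" if "m N > 0" for N
      proof -
        have "cmod (\<phi> N f / of_real (m N)) \<le> supn f" if "f \<in> A" for f
          using phi_le[OF that cmod_le_supn[OF that], of N] \<open>m N > 0\<close> by (simp add: norm_divide field_simps)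
        then show ?thesis unfolding dual_ball_def dual_space_def
          using phi_add phi_scale by (auto simp: add_divide_distrib intro!: exI[of _ 1])
      qed
      have t: "m (- N) = 1 - m N" using m1[of N] by simp
      \<comment> \<open>The normalised restrictions lie in the dual ball and the masses are the
        weights, so extremality makes the two restrictions equal.\<close>
      have "\<forall>f\<in>A. f k = of_real (m N) * (\<phi> N f / of_real (m N))
          + of_real (1 - m N) * (\<phi> (- N) f / of_real (m (- N)))"
        using phi_sum[of _ N] 3 by (simp add: t)
      then have "\<forall>f\<in>A. \<phi> N f / of_real (m N) = \<phi> (- N) f / of_real (m (- N))"
        using extremal[OF ball[OF 3(1)] ball[OF 3(2)] 3(1)] 3 t by simp
      then have "\<phi> N f / of_real (m N) = \<phi> (- N) f / of_real (m (- N))" using f by blast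
      then have "\<phi> N f * of_real (1 - m N) = \<phi> (- N) f * of_real (m N)"
        using 3 t by (simp add: field_simps)
      then have "\<phi> N f = (\<phi> N f + \<phi> (- N) f) * of_real (m N)" by (simp add: algebra_simps)
      then show ?thesis using phi_sum[OF f, of N] by (simp add: mult.commute)
    qed
  qed
  \<comment> \<open>The integral of \<open>Re f\<close> over this set is a multiple of
    \<open>Re (f k) = 0\<close>, but also at least half the mass of the set.\<close>
  have null: "m {x. Re (f x) > 1 / 2} = 0" if f: "f \<in> A" "f k = 0" for f
  proof -
    let ?N = "{x. Re (f x) > 1 / 2}"
    have "L (\<lambda>x. (1 / 2) * ind ?N x) \<le> R ?N f" unfolding R_def
      by (rule L_mono[OF BF_scale[OF ind_BF] Re_BF[OF f(1)]]) (auto simp: ind_def indicator_def)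
    then have "m ?N / 2 \<le> R ?N f" using Lscale[OF ind_BF[of ?N], of "1 / 2"] by (simp add: m_def)
    moreover have "R ?N f = 0" using restr[OF f(1), of ?N] f(2) by (simp add: \<phi>_def complex_eq_iff)
    ultimately show ?thesis using m0[of ?N] by simp
  qed
  \<comment> \<open>Null sets of this form cover \<open>- U\<close>; compactness makes finite
    subadditivity of \<open>m\<close> sufficient.\<close>
  define \<N> where "\<N> = {{x. Re (f x) > 1 / 2} | f. f \<in> A \<and> f k = 0}"
  have "compact (- U)" using U by (intro closed_imp_compact) auto
  moreover have "open N" if "N \<in> \<N>" for N
    using that by (auto simp: \<N>_def intro!: open_Collect_less continuous_intros cont)
  moreover have "- U \<subseteq> \<Union>\<N>"
  proof
    fix x assume "x \<in> - U"
    then have "x \<noteq> k" using U by auto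
    then obtain f where f: "f \<in> A" "f x \<noteq> f k" using separating by blast
    define g where "g = (\<lambda>y. (1 / (f x - f k)) * (f y - f k))"
    have "g \<in> A" unfolding g_def by (intro mem_intros f)
    moreover have "g k = 0" "g x = 1" using f by (auto simp: g_def)
    ultimately have "{x. Re (g x) > 1 / 2} \<in> \<N>" "x \<in> {x. Re (g x) > 1 / 2}" by (auto simp: \<N>_def)
    then show "x \<in> \<Union>\<N>" by blast
  qed
  ultimately obtain D where D: "D \<subseteq> \<N>" "finite D" "- U \<subseteq> \<Union>D" by (meson compactE)
  have "m (\<Union>D) = 0"
    using D(2,1)
  proof (induction D)
    case empty
    then show ?case using m_empty by simp
  next
    case (insert N D)
    then have "m N = 0" using null by (auto simp: \<N>_def)
    then show ?case using insert m_Un[of N "\<Union>D"] m0[of "N \<union> \<Union>D"] by simp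
  qed
  then have "upper_envelope k (ind (- U)) = 0"
    using m_mono[OF D(3)] m0[of "- U"] Lv by (simp add: m_def)
  then have "\<not> e \<le> upper_envelope k (ind (- U))" using U by simp
  then obtain f where f: "f \<in> A" "\<And>x. ind (- U) x \<le> Re (f x)" "Re (f k) < e"
    using upper_envelope_greatest[of "ind (- U)" e k] ind_BF[of "- U"] unfolding BF_def
    by (metis mem_Collect_eq not_le)
  show "\<exists>f\<in>A. (\<forall>x. Re (f x) \<le> 0) \<and> (\<forall>x. x \<notin> U \<longrightarrow> Re (f x) \<le> -1) \<and> (\<forall>x\<in>{k}. - e \<le> Re (f x))"
  proof (intro bexI conjI allI impI ballI)
    show "(\<lambda>x. - f x) \<in> A" by (intro mem_intros f)
    show "Re (- f x) \<le> 0" for x using f(2)[of x] by (cases "x \<in> U") (auto simp: ind_def)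
    show "Re (- f x) \<le> -1" if "x \<notin> U" for x using f(2)[of x] that by (simp add: ind_def)
    show "- e \<le> Re (- f x)" if "x \<in> {k}" for x using f(3) that by simp
  qed
qed

section \<open>Peakers\<close>

lemma choquet_boundary_iff: "k \<in> choquet_boundary A \<longleftrightarrow> peak_approximable {k}"
  using choquet_imp_peak_approximable peak_approximable_imp_choquet by blast

lemma ex_argmax_choquet:
  assumes "g \<in> A"
  obtains k where "k \<in> choquet_boundary A" "\<And>x. Re (g x) \<le> Re (g k)"
  using ex_argmax_peak_approximable[OF assms] unfolding choquet_boundary_iff by blast

text \<open>If \<open>Re f \<le> - e\<close> then \<open>1 + f / R\<close> is a contraction for large \<open>R\<close>, and a power of order \<open>R\<close> of it
  behaves like an exponential of \<open>f\<close>.\<close>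
lemma ex_peaking:
  assumes k: "k \<in> choquet_boundary A" and V: "open V" "k \<in> V" and e: "e > 0"
  obtains h where "h \<in> A" "\<And>x. cmod (h x) \<le> 1" "cmod (1 - h k) \<le> e"
    "\<And>x. x \<notin> V \<Longrightarrow> cmod (h x) \<le> e"
proof -
  obtain L :: nat where "real L \<ge> 1 / e + 1" using real_arch_simple by blast
  moreover have "1 / e > 0" using e by simp
  ultimately have L: "real L \<ge> 1 / e" "real L > 0" by (linarith, linarith)
  \<comment> \<open>Makes \<open>2 L (2 d) = e\<close>, the loss at \<open>k\<close> in the
    Bernoulli estimate.\<close>
  define d where "d = e / (4 * real L)"
  have d: "d > 0" using e L by (simp add: d_def)
  obtain f where f: "f \<in> A" "\<And>x. Re (f x) \<le> 0" "\<And>x. x \<notin> V \<Longrightarrow> Re (f x) \<le> -1"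
    "\<And>x. x \<in> {k} \<Longrightarrow> - d \<le> Re (f x)"
    using peak_approximableE[OF k[unfolded choquet_boundary_iff] V(1) _ d] V(2) by blast
  \<comment> \<open>The shift by \<open>d\<close> leaves room for the quadratic error in
    \<open>cmod (q x)\<close>; removing the imaginary part at \<open>k\<close> makes
    \<open>h k\<close> real.\<close>
  define g where "g = (\<lambda>x. f x - of_real d - \<i> * of_real (Im (f k)))"
  have g: "g \<in> A" unfolding g_def by (intro mem_intros f)
  have g1: "Re (g x) \<le> - d" for x using f(2)[of x] by (simp add: g_def)
  have g2: "Re (g x) \<le> -1" if "x \<notin> V" for x using f(3)[OF that] d by (simp add: g_def)
  define a where "a = - Re (g k)"
  have gk: "g k = of_real (- a)" "0 \<le> a" "a \<le> 2 * d"
    using f(4)[of k] g1[of k] d by (auto simp: g_def a_def complex_eq_iff)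
  obtain M where M: "M > 0" "\<And>x. cmod (g x) \<le> M" using bounded[OF g] by blast
  \<comment> \<open>\<open>M\<^sup>2 / R\<close> is then at most \<open>2 d\<close>, for use
    everywhere, and at most 1, for use off \<open>V\<close>; \<open>R \<ge> M\<close> keeps
    \<open>q k\<close> in the unit interval.\<close>
  obtain R :: nat where R: "real R \<ge> M\<^sup>2 / (2 * d) + M\<^sup>2 + M + 1" using real_arch_simple by blast
  have "M\<^sup>2 / (2 * d) \<ge> 0" "M\<^sup>2 \<ge> 0" using M d by simp_all
  then have R1: "real R \<ge> 1" "real R \<ge> M\<^sup>2" "real R \<ge> M" and "real R \<ge> M\<^sup>2 / (2 * d)" using R M by linarith+
  then have R2: "M\<^sup>2 \<le> 2 * d * real R" using d by (simp add: field_simps)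
  define q where "q = (\<lambda>x. 1 + of_real (1 / real R) * g x)"
  have q: "q \<in> A" unfolding q_def by (intro mem_intros g)
  have sq: "(cmod (q x))\<^sup>2 \<le> 1 + (2 * Re (g x) + M\<^sup>2 / real R) / real R" for x
  proof -
    have "(cmod (q x))\<^sup>2 = 1 + 2 * Re (g x) / real R + (cmod (g x))\<^sup>2 / (real R)\<^sup>2"
      unfolding cmod_power2 using R1 by (simp add: q_def power2_eq_square field_simps)
    also have "\<dots> \<le> 1 + 2 * Re (g x) / real R + M\<^sup>2 / (real R)\<^sup>2"
      using power_mono[OF M(2)[of x], of 2] by (simp add: divide_right_mono)
    finally show ?thesis by (simp add: add_divide_distrib power2_eq_square)
  qed
  have q1: "(cmod (q x))\<^sup>2 \<le> 1" for x
  proof -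
    have "M\<^sup>2 / real R \<le> 2 * d" using R2 R1 by (simp add: field_simps)
    then have "2 * Re (g x) + M\<^sup>2 / real R \<le> 0" using g1[of x] by linarith
    then have "(2 * Re (g x) + M\<^sup>2 / real R) / real R \<le> 0" using R1 by (simp add: divide_nonpos_pos)
    then show ?thesis using sq[of x] by linarith
  qed
  have q2: "(cmod (q x))\<^sup>2 \<le> 1 + - 1 / real R" if "x \<notin> V" for x
  proof -
    have "M\<^sup>2 / real R \<le> 1" using R1 by (simp add: field_simps)
    then have "2 * Re (g x) + M\<^sup>2 / real R \<le> -1" using g2[OF that] by linarith
    then have "(2 * Re (g x) + M\<^sup>2 / real R) / real R \<le> -1 / real R" using R1 by (intro divide_right_mono) auto
    then show ?thesis using sq[of x] by linarith
  qed
  \<comment> \<open>Off \<open>V\<close> this exponent gives modulus at most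
    \<open>exp (- L) \<le> e\<close>; the factor 2 accounts for the square in
    \<open>sq\<close>.\<close>
  define h where "h = (\<lambda>x. q x ^ (2 * (R * L)))"
  have h_norm: "cmod (h x) = ((cmod (q x))\<^sup>2) ^ (R * L)" for x
    by (simp add: h_def norm_power power_mult)
  show thesis
  proof (rule that)
    show "h \<in> A" unfolding h_def by (intro mem_intros q)
    show "cmod (h x) \<le> 1" for x using q1[of x] by (simp add: h_norm power_le_one)
    show "cmod (h x) \<le> e" if "x \<notin> V" for x
    proof -
      have "cmod (h x) \<le> (exp (- 1 / real R)) ^ (R * L)"
        unfolding h_norm using q2[OF that] exp_ge_add_one_self[of "- 1 / real R"]
        by (intro power_mono) auto
      also have "\<dots> = exp (- real L)"
        using R1 by (simp flip: exp_of_nat_mult)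
      also have "\<dots> \<le> 1 / (1 + real L)"
        using exp_ge_add_one_self[of "real L"] by (simp add: exp_minus field_simps)
      also have "\<dots> \<le> e" using L e by (simp add: field_simps)
      finally show ?thesis .
    qed
    have "a \<le> M" using M(2)[of k] gk by (simp add: norm_of_real)
    have aR: "a / real R \<le> 1" using \<open>a \<le> M\<close> R1 by (simp add: field_simps)
    have hk: "h k = of_real ((1 + - (a / real R)) ^ (2 * (R * L)))"
      by (simp add: h_def q_def gk)
    have "1 + real (2 * (R * L)) * (- (a / real R)) \<le> (1 + - (a / real R)) ^ (2 * (R * L))"
      by (rule Bernoulli_inequality) (use aR in simp)
    moreover have "real (2 * (R * L)) * (- (a / real R)) = - (2 * real L * a)"
      using R1 by simp
    moreover have "2 * real L * a \<le> e"
    proof -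
      have "2 * real L * a \<le> 2 * real L * (2 * d)" using gk(3) by (intro mult_left_mono) auto
      also have "\<dots> = e" using L by (simp add: d_def)
      finally show ?thesis .
    qed
    moreover have "(1 + - (a / real R)) ^ (2 * (R * L)) \<le> 1"
      using aR gk(2) R1 by (intro power_le_one) auto
    ultimately have "\<bar>1 - (1 + - (a / real R)) ^ (2 * (R * L))\<bar> \<le> e" by linarith
    moreover have "1 - h k = of_real (1 - (1 + - (a / real R)) ^ (2 * (R * L)))" by (simp add: hk)
    ultimately show "cmod (1 - h k) \<le> e" by (simp only: norm_of_real)
  qed
qed

text \<open>The last condition confines the values to a thin ellipse with foci 0 and 1, so
  \<open>h\<close> acts as a cutoff function: \<open>f (1 - h) + \<theta> h\<close> has norm at most
  \<open>1 + e\<close> for \<open>f\<close> in the unit ball and unimodular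
  \<open>\<theta>\<close>.\<close>

definition peakers :: "'a \<Rightarrow> 'a set \<Rightarrow> real \<Rightarrow> ('a \<Rightarrow> complex) set" where
  "peakers k V e = {h \<in> A. (\<forall>x. cmod (h x) \<le> 1) \<and> cmod (1 - h k) \<le> e \<and>
     (\<forall>x. x \<notin> V \<longrightarrow> cmod (h x) \<le> e) \<and> (\<forall>x. cmod (h x) + cmod (1 - h x) \<le> 1 + e)}"

lemma peakersD:
  assumes "h \<in> peakers k V e"
  shows "h \<in> A" "\<And>x. cmod (h x) \<le> 1" "cmod (1 - h k) \<le> e" "\<And>x. x \<notin> V \<Longrightarrow> cmod (h x) \<le> e"
    "\<And>x. cmod (h x) + cmod (1 - h x) \<le> 1 + e"
  using assms unfolding peakers_def by blast+

lemma peakers_mono: "V \<subseteq> V' \<Longrightarrow> e \<le> e' \<Longrightarrow> peakers k V e \<subseteq> peakers k V' e'"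
  unfolding peakers_def by (auto intro: order_trans)

lemma peakers_convex:
  assumes g: "g \<in> peakers k V e" and h: "h \<in> peakers k V e" and t: "0 \<le> t" "t \<le> 1"
  shows "(\<lambda>x. of_real t * g x + of_real (1 - t) * h x) \<in> peakers k V e"
proof -
  have comb: "cmod (of_real t * z + of_real (1 - t) * w) \<le> t * cmod z + (1 - t) * cmod w" for z w
    using norm_triangle_ineq[of "of_real t * z" "of_real (1 - t) * w"] t
    by (simp add: norm_mult del: of_real_diff)
  have one: "1 - (of_real t * z + of_real (1 - t) * w) = of_real t * (1 - z) + of_real (1 - t) * (1 - w)"
    for z w :: complex by (simp add: algebra_simps)
  have conv: "t * a + (1 - t) * b \<le> c" if "a \<le> c" "b \<le> c" for a b c :: real
    using convex_bound_le[OF that, of t "1 - t"] t by simp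
  note G = peakersD[OF g] and H = peakersD[OF h]
  show ?thesis unfolding peakers_def mem_Collect_eq
  proof (intro conjI allI impI)
    show "(\<lambda>x. of_real t * g x + of_real (1 - t) * h x) \<in> A" by (intro mem_intros G H)
    show "cmod (of_real t * g x + of_real (1 - t) * h x) \<le> 1" for x
      using order_trans[OF comb conv[OF G(2) H(2)]] .
    show "cmod (1 - (of_real t * g k + of_real (1 - t) * h k)) \<le> e"
      unfolding one using order_trans[OF comb conv[OF G(3) H(3)]] .
    show "cmod (of_real t * g x + of_real (1 - t) * h x) \<le> e" if "x \<notin> V" for x
      using order_trans[OF comb conv[OF G(4)[OF that] H(4)[OF that]]] .
    show "cmod (of_real t * g x + of_real (1 - t) * h x) + cmod (1 - (of_real t * g x + of_real (1 - t) * h x)) \<le> 1 + e" for x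
      unfolding one using comb[of "g x" "h x"] comb[of "1 - g x" "1 - h x"] conv[OF G(5)[of x] H(5)[of x]]
      by (simp add: algebra_simps)
  qed
qed

text \<open>Averaging successively sharper peaking functions: at each point all but one of them are close
  to \<open>0\<close> or to \<open>1\<close>, so the average nearly takes values in the unit interval.\<close>
lemma ex_peaking_sum:
  assumes k: "k \<in> choquet_boundary A" and V: "open V" "k \<in> V" and e: "e > 0"
  shows "\<exists>s\<in>A. (\<forall>x. cmod (s x) \<le> real n) \<and> cmod (of_nat n - s k) \<le> real n * e \<and>
    (\<forall>x. x \<notin> V \<longrightarrow> cmod (s x) \<le> real n * e) \<and>
    (\<forall>x. cmod (s x) + cmod (of_nat n - s x) \<le> real n + 3 + 2 * real n * e)"
  using V
proof (induction n arbitrary: V)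
  case 0
  then show ?case by (intro bexI[OF _ const_mem[of 0]]) auto
next
  case (Suc n)
  obtain h where h: "h \<in> A" "\<And>x. cmod (h x) \<le> 1" "cmod (1 - h k) \<le> e / 2"
    "\<And>x. x \<notin> V \<Longrightarrow> cmod (h x) \<le> e / 2"
    using ex_peaking[OF k Suc.prems, of "e / 2"] e by auto
  \<comment> \<open>The later functions are to be small off \<open>W\<close>, that is, wherever
    \<open>h\<close> is not yet close to 1.\<close>
  define W where "W = V \<inter> {x. cmod (1 - h x) < e}"
  have "open W" unfolding W_def
    by (intro open_Int Suc.prems open_Collect_less continuous_intros cont h)
  moreover have "k \<in> W" using Suc.prems h(3) e by (simp add: W_def)
  ultimately obtain s where s: "s \<in> A" "\<And>x. cmod (s x) \<le> real n" "cmod (of_nat n - s k) \<le> real n * e"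
    "\<And>x. x \<notin> W \<Longrightarrow> cmod (s x) \<le> real n * e"
    "\<And>x. cmod (s x) + cmod (of_nat n - s x) \<le> real n + 3 + 2 * real n * e"
    using Suc.IH[of W] by blast
  have tri: "cmod (of_nat (Suc n) - (h x + s x)) \<le> cmod (1 - h x) + cmod (of_nat n - s x)" for x
    using norm_triangle_ineq[of "1 - h x" "of_nat n - s x"] by (simp add: algebra_simps)
  have tri': "cmod (h x + s x) \<le> cmod (h x) + cmod (s x)" for x by (rule norm_triangle_ineq)
  show ?case
  proof (intro bexI conjI allI impI)
    show "(\<lambda>x. h x + s x) \<in> A" by (intro mem_intros h s)
    show "cmod (h x + s x) \<le> real (Suc n)" for x using tri'[of x] h(2)[of x] s(2)[of x] by simp
    show "cmod (of_nat (Suc n) - (h k + s k)) \<le> real (Suc n) * e"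
      using tri[of k] h(3) s(3) e by (simp add: algebra_simps)
    show "cmod (h x + s x) \<le> real (Suc n) * e" if "x \<notin> V" for x
    proof -
      have "x \<notin> W" using that by (simp add: W_def)
      then show ?thesis using tri'[of x] h(4)[OF that] s(4)[of x] e by (simp add: algebra_simps)
    qed
    show "cmod (h x + s x) + cmod (of_nat (Suc n) - (h x + s x)) \<le> real (Suc n) + 3 + 2 * real (Suc n) * e" for x
    \<comment> \<open>On \<open>W\<close> the value of \<open>h\<close> is near 1 and the bound for
      \<open>s\<close> is passed on; off \<open>W\<close> the sum \<open>s\<close> is small and
      \<open>h\<close> alone is uncontrolled, whence the constant 3.\<close>
    proof (cases "x \<in> W")
      case True
      then have "cmod (1 - h x) < e" by (simp add: W_def)
      then show ?thesis using tri[of x] tri'[of x] h(2)[of x] s(5)[of x] e by (simp add: algebra_simps)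
    next
      case False
      have "cmod (1 - h x) \<le> 2" using norm_triangle_ineq4[of 1 "h x"] h(2)[of x] by simp
      moreover have "cmod (of_nat n - s x) \<le> real n + real n * e"
        using norm_triangle_ineq4[of "of_nat n" "s x"] s(4)[OF False] by simp
      ultimately show ?thesis using tri[of x] tri'[of x] h(2)[of x] s(4)[OF False] e
        by (simp add: algebra_simps)
    qed
  qed
qed

lemma peakers_nonempty:
  assumes k: "k \<in> choquet_boundary A" and V: "open V" "k \<in> V" and e: "e > 0"
  shows "peakers k V e \<noteq> {}"
proof -
  \<comment> \<open>After division by \<open>n\<close> the constant 3 becomes
    \<open>3 / n \<le> e / 2\<close>.\<close>
  obtain n :: nat where n: "real n \<ge> 6 / e + 1" using real_arch_simple by blast
  have "6 / e > 0" using e by simp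
  then have n1: "real n > 0" "6 \<le> real n * e" using n e by (linarith, simp add: field_simps)
  obtain s where s: "s \<in> A" "\<And>x. cmod (s x) \<le> real n" "cmod (of_nat n - s k) \<le> real n * (e / 4)"
    "\<And>x. x \<notin> V \<Longrightarrow> cmod (s x) \<le> real n * (e / 4)"
    "\<And>x. cmod (s x) + cmod (of_nat n - s x) \<le> real n + 3 + 2 * real n * (e / 4)"
    using ex_peaking_sum[OF k V, of "e / 4" n] e by auto
  define h where "h = (\<lambda>x. of_real (1 / real n) * s x)"
  have h: "cmod (h x) = cmod (s x) / real n" for x by (simp add: h_def norm_mult norm_divide)
  have h': "cmod (1 - h x) = cmod (of_nat n - s x) / real n" for x
  proof -
    have "1 - h x = of_real (1 / real n) * (of_nat n - s x)" using n1 by (simp add: h_def field_simps)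
    then show ?thesis by (simp add: norm_mult norm_divide)
  qed
  have "h \<in> peakers k V e" unfolding peakers_def mem_Collect_eq
  proof (intro conjI allI impI)
    show "h \<in> A" unfolding h_def by (intro mem_intros s)
    show "cmod (h x) \<le> 1" for x using s(2)[of x] n1 by (simp add: h field_simps)
    show "cmod (1 - h k) \<le> e" using s(3) n1 by (simp add: h' field_simps)
    show "cmod (h x) \<le> e" if "x \<notin> V" for x using s(4)[OF that] n1 by (simp add: h field_simps)
    show "cmod (h x) + cmod (1 - h x) \<le> 1 + e" for x
      using s(5)[of x] n1 by (simp add: h h' add_divide_distrib[symmetric] field_simps)
  qed
  then show ?thesis by blast
qed

section \<open>The Baire property of the Choquet boundary\<close>

lemma choquet_point_avoiding_finite:
  assumes noiso: "\<forall>k. \<not> isolated_point k (choquet_boundary A)"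
    and V: "open V" "V \<inter> choquet_boundary A \<noteq> {}" and F: "finite F"
  obtains k where "k \<in> V" "k \<in> choquet_boundary A" "k \<notin> F"
proof -
  obtain k where k: "k \<in> V" "k \<in> choquet_boundary A" using V by blast
  \<comment> \<open>\<open>k\<close> itself is kept; as it is not isolated, this neighbourhood of it
    contains another boundary point, which lies outside \<open>F\<close>.\<close>
  have "open (V - (F - {k}))" using V F by (intro open_Diff finite_imp_closed) auto
  then have "(V - (F - {k})) \<inter> choquet_boundary A \<noteq> {k}"
    using noiso k unfolding isolated_point_def by blast
  then obtain k' where "k' \<in> V - (F - {k})" "k' \<in> choquet_boundary A" "k' \<noteq> k" using k by blast
  then show thesis using that by blast
qed

text \<open>A small multiple of a peaker at a nearby boundary point outside \<open>F\<close> moves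
  the maximum of \<open>Re f\<close> into \<open>V - F\<close> and keeps a fixed fraction of the
  gap.\<close>

lemma ex_argmax_approaching:
  assumes noiso: "\<forall>k. \<not> isolated_point k (choquet_boundary A)"
    and f: "f \<in> A" and k: "k \<in> choquet_boundary A" and V: "open V"
    and max: "\<And>x. Re (f x) \<le> Re (f k)" and gap: "\<And>x. x \<notin> V \<Longrightarrow> Re (f x) + d \<le> Re (f k)"
    and d: "d > 0" and F: "finite F"
  obtains f' k' V' where "f' \<in> A" "k' \<in> choquet_boundary A" "open V'"
    "\<And>x. Re (f' x) \<le> Re (f' k')" "\<And>x. x \<notin> V' \<Longrightarrow> Re (f' x) + d / 32 \<le> Re (f' k')"
    "V' \<subseteq> V - F" "\<And>x. cmod (f' x - f x) \<le> d / 16"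
proof -
  define W where "W = V \<inter> {x. Re (f k) - d / 64 < Re (f x)}"
  have "open W" unfolding W_def by (intro open_Int V open_Collect_less continuous_intros cont f)
  moreover have "k \<in> V" using gap[of k] d by force
  then have "k \<in> W" using d by (simp add: W_def)
  ultimately obtain k1 where k1: "k1 \<in> W" "k1 \<in> choquet_boundary A" "k1 \<notin> F"
    using choquet_point_avoiding_finite[OF noiso _ _ F] k by blast
  define V' where "V' = V - F"
  have V': "open V'" "k1 \<in> V'" using V F k1 by (auto simp: V'_def W_def intro: open_Diff finite_imp_closed)
  then obtain h where "h \<in> peakers k1 V' (1 / 8)" using peakers_nonempty[OF k1(2), of V' "1 / 8"] by auto
  note h = peakersD[OF this]
  define f' where "f' = (\<lambda>x. f x + of_real (d / 16) * h x)"
  have f': "f' \<in> A" unfolding f'_def by (intro mem_intros f h)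
  obtain k' where k': "k' \<in> choquet_boundary A" "\<And>x. Re (f' x) \<le> Re (f' k')"
    using ex_argmax_choquet[OF f'] by blast
  \<comment> \<open>At \<open>k1\<close> at most \<open>d / 64\<close> is lost and at least
    \<open>7 d / 128\<close> is gained; off \<open>V'\<close> the gain is at most
    \<open>d / 128\<close>. The difference is the new gap \<open>d / 32\<close>.\<close>
  have low: "Re (f k) - d / 64 + d / 16 * (7 / 8) \<le> Re (f' k')"
  proof -
    have "7 / 8 \<le> Re (h k1)" using h(3) complex_Re_le_cmod[of "1 - h k1"] by simp
    then have "d / 16 * (7 / 8) \<le> d / 16 * Re (h k1)" using d by (intro mult_left_mono) auto
    then have "Re (f k) - d / 64 + d / 16 * (7 / 8) \<le> Re (f' k1)"
      using k1(1) by (simp add: f'_def W_def)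
    then show ?thesis using k'(2)[of k1] by linarith
  qed
  show thesis
  proof (rule that[OF f' k'(1) V'(1) k'(2)])
    show "Re (f' x) + d / 32 \<le> Re (f' k')" if "x \<notin> V'" for x
    proof -
      have "Re (h x) \<le> 1 / 8" using h(4)[OF that] complex_Re_le_cmod[of "h x"] by linarith
      then have "d / 16 * Re (h x) \<le> d / 16 * (1 / 8)" using d by (intro mult_left_mono) auto
      then have "Re (f' x) \<le> Re (f k) + d / 16 * (1 / 8)" using max[of x] by (simp add: f'_def)
      then show ?thesis using low d by linarith
    qed
    show "V' \<subseteq> V - F" by (simp add: V'_def)
    show "cmod (f' x - f x) \<le> d / 16" for x
      using h(2)[of x] d by (simp add: f'_def norm_mult mult_left_le)
  qed
qed

text \<open>The maximum points of a rapidly convergent sum of peakers are trapped in a prescribed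
  decreasing sequence of open sets.\<close>
lemma choquet_point_avoiding_countable:
  assumes noiso: "\<forall>k. \<not> isolated_point k (choquet_boundary A)"
    and V0: "open V0" "V0 \<inter> choquet_boundary A \<noteq> {}" and D: "countable D"
  obtains s where "s \<in> V0" "s \<in> choquet_boundary A" "s \<notin> D"
proof -
  \<comment> \<open>The first peaker has real part at least 3/4 at its maximum and at most 1/4 off
    \<open>V0\<close>, whence the gap 1/2; each step divides it by 32.\<close>
  define d :: "nat \<Rightarrow> real" where "d n = (1 / 2) / 32 ^ n" for n
  have d: "d n > 0" "d (Suc n) = d n / 32" for n by (simp_all add: d_def)
  \<comment> \<open>A stage is a function, a maximum point and an open set with a gap off it. By
    \<open>Q\<close> the next open set omits the \<open>n\<close>th point of \<open>D\<close>; for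
    empty \<open>D\<close> the enumeration gives arbitrary points, whose removal does no
    harm.\<close>
  define P :: "nat \<Rightarrow> ('a \<Rightarrow> complex) \<times> 'a \<times> 'a set \<Rightarrow> bool" where
    "P n s = (case s of (f, k, V) \<Rightarrow> f \<in> A \<and> k \<in> choquet_boundary A \<and> open V \<and> V \<subseteq> V0 \<and>
      (\<forall>x. Re (f x) \<le> Re (f k)) \<and> (\<forall>x. x \<notin> V \<longrightarrow> Re (f x) + d n \<le> Re (f k)))" for n s
  define Q :: "nat \<Rightarrow> ('a \<Rightarrow> complex) \<times> 'a \<times> 'a set \<Rightarrow> ('a \<Rightarrow> complex) \<times> 'a \<times> 'a set \<Rightarrow> bool" where
    "Q n s s' = (snd (snd s') \<subseteq> snd (snd s) - {from_nat_into D n} \<and>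
      (\<forall>x. cmod (fst s' x - fst s x) \<le> d n / 16))" for n s s'
  have "\<exists>S. \<forall>n. P n (S n) \<and> Q n (S n) (S (Suc n))"
  proof (rule dependent_nat_choice)
    obtain k0 where k0: "k0 \<in> V0" "k0 \<in> choquet_boundary A" using V0 by blast
    obtain h where "h \<in> peakers k0 V0 (1 / 4)" using peakers_nonempty[OF k0(2) V0(1) k0(1), of "1 / 4"] by auto
    note h = peakersD[OF this]
    obtain k where k: "k \<in> choquet_boundary A" "\<And>x. Re (h x) \<le> Re (h k)"
      using ex_argmax_choquet[OF h(1)] by blast
    have "3 / 4 \<le> Re (h k0)" using h(3) complex_Re_le_cmod[of "1 - h k0"] by simp
    then have "3 / 4 \<le> Re (h k)" using k(2)[of k0] by simp
    moreover have "Re (h x) \<le> 1 / 4" if "x \<notin> V0" for x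
      using h(4)[OF that] complex_Re_le_cmod[of "h x"] by linarith
    ultimately have "Re (h x) + d 0 \<le> Re (h k)" if "x \<notin> V0" for x using that by (force simp: d_def)
    then have "P 0 (h, k, V0)" using h(1) k V0(1) by (simp add: P_def)
    then show "\<exists>s. P 0 s" by blast
  next
    fix s n assume P: "P n s"
    obtain f k V where s: "s = (f, k, V)" by (cases s)
    have fkV: "f \<in> A" "k \<in> choquet_boundary A" "open V" "V \<subseteq> V0" "\<And>x. Re (f x) \<le> Re (f k)"
      "\<And>x. x \<notin> V \<Longrightarrow> Re (f x) + d n \<le> Re (f k)"
      using P by (auto simp: P_def s)
    obtain f' k' V' where "f' \<in> A" "k' \<in> choquet_boundary A" "open V'"
      "\<And>x. Re (f' x) \<le> Re (f' k')" "\<And>x. x \<notin> V' \<Longrightarrow> Re (f' x) + d n / 32 \<le> Re (f' k')"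
      and V': "V' \<subseteq> V - {from_nat_into D n}" and *: "\<And>x. cmod (f' x - f x) \<le> d n / 16"
      using ex_argmax_approaching[OF noiso fkV(1,2,3,5,6) d(1), of "{from_nat_into D n}"] by blast
    moreover from V' have "V' \<subseteq> V0" using fkV(4) by blast
    ultimately have "P (Suc n) (f', k', V')" by (simp add: P_def d(2))
    moreover have "Q n s (f', k', V')" using V' * by (simp add: Q_def s)
    ultimately show "\<exists>s'. P (Suc n) s' \<and> Q n s s'" by blast
  qed
  then obtain S where S: "\<And>n. P n (S n)" "\<And>n. Q n (S n) (S (Suc n))" by blast
  define X where "X n = fst (S n)" for n
  define K where "K n = fst (snd (S n))" for n
  define V where "V n = snd (snd (S n))" for n
  have X: "X n \<in> A" and VV0: "V n \<subseteq> V0" and gap: "x \<notin> V n \<Longrightarrow> Re (X n x) + d n \<le> Re (X n (K n))" for n x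
    using S(1)[of n] by (auto simp: P_def X_def K_def V_def split: prod.splits)
  have VS: "V (Suc n) \<subseteq> V n - {from_nat_into D n}" and XS: "cmod (X (Suc n) x - X n x) \<le> d n / 16" for n x
    using S(2)[of n] by (auto simp: Q_def X_def V_def)
  have diff: "cmod (X (n + m) x - X n x) \<le> d n / 8 - d (n + m) / 8" for n m x
  proof (induction m)
    case (Suc m)
    have "cmod (X (n + Suc m) x - X n x) \<le> cmod (X (Suc (n + m)) x - X (n + m) x) + cmod (X (n + m) x - X n x)"
      using norm_triangle_ineq[of "X (Suc (n + m)) x - X (n + m) x" "X (n + m) x - X n x"] by simp
    also have "\<dots> \<le> d (n + m) / 16 + (d n / 8 - d (n + m) / 8)" using XS Suc by (intro add_mono) auto
    also have "\<dots> \<le> d n / 8 - d (n + Suc m) / 8" using d(1)[of "n + m"] by (simp add: d(2))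
    finally show ?case .
  qed simp
  have d_lim: "d \<longlonglongrightarrow> 0"
    unfolding d_def by (intro tendsto_eq_intros LIMSEQ_divide_realpow_zero) auto
  have "Cauchy (\<lambda>n. X n x)" for x
  proof (rule metric_CauchyI)
    fix e :: real assume "e > 0"
    then obtain N where N: "d N < e" using order_tendstoD(2)[OF d_lim, of e] eventually_happens' by force
    have *: "cmod (X n x - X N x) \<le> d N / 8" if "n \<ge> N" for n
      using diff[of N "n - N" x] that d(1)[of n] by simp
    have "dist (X m x) (X n x) < e" if "m \<ge> N" "n \<ge> N" for m n
    proof -
      have "dist (X m x) (X n x) \<le> d N / 8 + d N / 8"
        using *[OF that(1)] *[OF that(2)] dist_triangle2[of "X m x" "X n x" "X N x"]
        by (simp add: dist_norm)
      then show ?thesis using N d(1)[of N] by linarith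
    qed
    then show "\<exists>M. \<forall>m\<ge>M. \<forall>n\<ge>M. dist (X m x) (X n x) < e" by blast
  qed
  then have "\<forall>x. \<exists>y. (\<lambda>n. X n x) \<longlonglongrightarrow> y" using Cauchy_convergent convergent_def by blast
  then obtain l where l: "\<And>x. (\<lambda>n. X n x) \<longlonglongrightarrow> l x" by metis
  have Xl: "cmod (X n x - l x) \<le> d n / 8" for n x
  proof -
    have "(\<lambda>m. cmod (X (m + n) x - X n x)) \<longlonglongrightarrow> cmod (l x - X n x)"
      by (intro tendsto_intros LIMSEQ_ignore_initial_segment l)
    moreover have "cmod (X (m + n) x - X n x) \<le> d n / 8" for m
      using diff[of n m x] d(1)[of "n + m"] by (simp add: add.commute)
    ultimately have "cmod (l x - X n x) \<le> d n / 8" by (intro LIMSEQ_le_const2) auto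
    then show ?thesis by (simp add: norm_minus_commute)
  qed
  have "uniform_limit UNIV X l sequentially"
  proof (rule uniform_limitI)
    fix e :: real assume "e > 0"
    then have "\<forall>\<^sub>F n in sequentially. d n < e" by (rule order_tendstoD(2)[OF d_lim])
    then show "\<forall>\<^sub>F n in sequentially. \<forall>x\<in>UNIV. dist (X n x) (l x) < e"
    proof eventually_elim
      case (elim n)
      have "cmod (X n x - l x) < e" for x using Xl[of n x] d(1)[of n] elim by linarith
      then show ?case by (simp add: dist_norm)
    qed
  qed
  then have "continuous_on UNIV l"
    by (rule uniform_limit_theorem[rotated]) (simp_all add: cont X)
  moreover have "(\<lambda>n. supn (\<lambda>x. X n x - l x)) \<longlonglongrightarrow> 0"
  proof (rule tendsto_sandwich)
    have "0 \<le> supn (\<lambda>x. X n x - l x)" for n by (rule supn_nonneg[OF Xl])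
    then show "\<forall>\<^sub>F n in sequentially. 0 \<le> supn (\<lambda>x. X n x - l x)" by simp
    show "\<forall>\<^sub>F n in sequentially. supn (\<lambda>x. X n x - l x) \<le> d n / 8"
      by (intro always_eventually allI supn_le Xl)
    show "(\<lambda>n. d n / 8) \<longlonglongrightarrow> 0" using d_lim by (intro tendsto_eq_intros) auto
  qed simp
  ultimately have "l \<in> A" by (rule limit_mem[OF X])
  then obtain s where s: "s \<in> choquet_boundary A" "\<And>x. Re (l x) \<le> Re (l s)"
    using ex_argmax_choquet by blast
  \<comment> \<open>The limit is within \<open>d n / 8\<close> of \<open>X n\<close>, so some of the
    gap \<open>d n\<close> off \<open>V n\<close> persists and the maximum point \<open>s\<close>
    must lie in \<open>V n\<close>.\<close>
  have sV: "s \<in> V n" for n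
  proof (rule ccontr)
    assume "s \<notin> V n"
    then have "Re (X n s) + d n \<le> Re (X n (K n))" by (rule gap)
    moreover have "Re (l s) \<le> Re (X n s) + d n / 8"
      using Xl[of n s] complex_Re_le_cmod[of "l s - X n s"] by (simp add: norm_minus_commute)
    moreover have "Re (X n (K n)) \<le> Re (l (K n)) + d n / 8"
      using Xl[of n "K n"] complex_Re_le_cmod[of "X n (K n) - l (K n)"] by simp
    ultimately show False using s(2)[of "K n"] d(1)[of n] by linarith
  qed
  have "s \<notin> D"
  proof
    assume "s \<in> D"
    then obtain n where "from_nat_into D n = s" using from_nat_into_surj[OF D] by blast
    then show False using sV[of "Suc n"] VS[of n] by blast
  qed
  then show thesis using that s(1) sV[of 0] VV0[of 0] by blast
qed

section \<open>Points charged by a functional\<close>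

lemma dual_sum:
  assumes "\<phi> \<in> dual_space A" "finite S" "\<And>s. s \<in> S \<Longrightarrow> h s \<in> A"
  shows "\<phi> (\<lambda>x. \<Sum>s\<in>S. c s * h s x) = (\<Sum>s\<in>S. c s * \<phi> (h s))"
  using assms(2,3)
proof (induction S)
  case empty
  then show ?case using dual_scale[OF assms(1) const_mem[of 0], of 0] by simp
next
  case (insert s S)
  have "\<phi> (\<lambda>x. c s * h s x + (\<Sum>s\<in>S. c s * h s x)) = \<phi> (\<lambda>x. c s * h s x) + \<phi> (\<lambda>x. \<Sum>s\<in>S. c s * h s x)"
    using insert.prems by (intro dual_add[OF assms(1)] mem_intros) auto
  then show ?case using insert dual_scale[OF assms(1), of "h s" "c s"] by simp
qed

text \<open>Stands for an atom of size at least \<open>\<delta>\<close> at \<open>s\<close> of a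
  measure representing \<open>\<phi>\<close>.\<close>

definition heavy :: "(('a \<Rightarrow> complex) \<Rightarrow> complex) \<Rightarrow> real \<Rightarrow> 'a \<Rightarrow> bool" where
  "heavy \<phi> \<delta> s \<longleftrightarrow> (\<forall>V e. open V \<and> s \<in> V \<and> e > 0 \<longrightarrow> (\<exists>h\<in>peakers s V e. \<delta> \<le> cmod (\<phi> h)))"

text \<open>Peakers in disjoint neighbourhoods, with unimodular coefficients aligning the values of
  \<open>\<phi>\<close>, have a sum of norm at most 2 on which \<open>\<phi>\<close> is at least
  \<open>card S\<close> times \<open>\<delta>\<close>.\<close>

lemma card_heavy_le:
  assumes phi: "\<phi> \<in> dual_space A" "\<And>f. f \<in> A \<Longrightarrow> cmod (\<phi> f) \<le> C * supn f" and C: "C \<ge> 0"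
    and S: "finite S" "\<And>s. s \<in> S \<Longrightarrow> heavy \<phi> \<delta> s"
  shows "real (card S) * \<delta> \<le> 2 * C"
proof -
  obtain V where V: "\<And>s. s \<in> S \<Longrightarrow> open (V s) \<and> s \<in> V s"
    "\<And>s t x. s \<in> S \<Longrightarrow> t \<in> S \<Longrightarrow> s \<noteq> t \<Longrightarrow> x \<in> V s \<Longrightarrow> x \<notin> V t"
    using finite_disjoint_neighbourhoods[OF S(1)] by metis
  \<comment> \<open>Outside their neighbourhoods all peakers together contribute at most 1.\<close>
  define e where "e = 1 / (real (card S) + 1)"
  have e: "e > 0" "real (card S) * e \<le> 1" by (simp_all add: e_def)
  have "\<forall>s\<in>S. \<exists>h\<in>peakers s (V s) e. \<delta> \<le> cmod (\<phi> h)"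
    using S(2) V(1) e(1) unfolding heavy_def by blast
  then obtain h where h: "\<And>s. s \<in> S \<Longrightarrow> h s \<in> peakers s (V s) e" "\<And>s. s \<in> S \<Longrightarrow> \<delta> \<le> cmod (\<phi> (h s))"
    by metis
  have "\<forall>s. \<exists>c. cmod c = 1 \<and> c * \<phi> (h s) = of_real (cmod (\<phi> (h s)))"
    using ex_unimodular by blast
  then obtain c where c: "\<And>s. cmod (c s) = 1" "\<And>s. c s * \<phi> (h s) = of_real (cmod (\<phi> (h s)))"
    using choice[of "\<lambda>s c. cmod c = 1 \<and> c * \<phi> (h s) = of_real (cmod (\<phi> (h s)))"] by blast
  define f where "f = (\<lambda>x. \<Sum>s\<in>S. c s * h s x)"
  have f: "f \<in> A" unfolding f_def using peakersD(1)[OF h(1)] by (intro mem_intros)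
  have "cmod (f x) \<le> 2" for x
  proof -
    have "cmod (f x) \<le> (\<Sum>s\<in>S. cmod (h s x))"
      unfolding f_def by (rule order_trans[OF norm_sum]) (simp add: norm_mult c)
    also have "\<dots> \<le> (\<Sum>s\<in>S. (if x \<in> V s then 1 else 0) + e)"
    proof (rule sum_mono)
      fix s assume s: "s \<in> S"
      show "cmod (h s x) \<le> (if x \<in> V s then 1 else 0) + e"
        using peakersD(2)[OF h(1)[OF s], of x] peakersD(4)[OF h(1)[OF s], of x] e(1) by auto
    qed
    also have "\<dots> = real (card (S \<inter> {s. x \<in> V s})) + real (card S) * e"
      using S(1) by (simp add: sum.distrib sum.If_cases)
    also have "card (S \<inter> {s. x \<in> V s}) \<le> 1"
      using V(2) S(1) by (intro card_le_Suc0_iff_eq[THEN iffD2, folded One_nat_def]) blast+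
    finally show ?thesis using e(2) by simp
  qed
  then have "supn f \<le> 2" by (rule supn_le)
  then have "cmod (\<phi> f) \<le> C * 2" using phi(2)[OF f] mult_left_mono[OF _ C] order_trans by blast
  moreover have "\<phi> f = of_real (\<Sum>s\<in>S. cmod (\<phi> (h s)))"
    unfolding f_def using dual_sum[OF phi(1) S(1), of h c] peakersD(1)[OF h(1)] c(2) by simp
  moreover have card: "real (card S) * \<delta> \<le> (\<Sum>s\<in>S. cmod (\<phi> (h s)))"
    using sum_bounded_below[of S \<delta> "\<lambda>s. cmod (\<phi> (h s))"] h(2) by simp
  ultimately have "cmod (of_real (\<Sum>s\<in>S. cmod (\<phi> (h s)))) \<le> C * 2" by simp
  then have "(\<Sum>s\<in>S. cmod (\<phi> (h s))) \<le> C * 2" unfolding norm_of_real by linarith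
  with card show ?thesis by linarith
qed

lemma finite_heavy:
  assumes phi: "\<phi> \<in> dual_space A" and d: "\<delta> > 0"
  shows "finite {s. heavy \<phi> \<delta> s}"
proof (rule ccontr)
  assume inf: "infinite {s. heavy \<phi> \<delta> s}"
  obtain C where C: "\<And>f. f \<in> A \<Longrightarrow> cmod (\<phi> f) \<le> C * supn f" using phi unfolding dual_space_def by blast
  have C': "cmod (\<phi> f) \<le> \<bar>C\<bar> * supn f" if "f \<in> A" for f
  proof -
    have "0 \<le> supn f" using cmod_le_supn[OF that] norm_ge_zero order_trans by blast
    then show ?thesis using C[OF that] mult_right_mono[OF abs_ge_self[of C]] order_trans by blast
  qed
  obtain n :: nat where n: "real n > 2 * \<bar>C\<bar> / \<delta>" using reals_Archimedean2 by blast
  obtain S where S: "finite S" "card S = n" "S \<subseteq> {s. heavy \<phi> \<delta> s}"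
    using infinite_arbitrarily_large[OF inf] by blast
  have "real (card S) * \<delta> \<le> 2 * \<bar>C\<bar>"
    by (rule card_heavy_le[OF phi C']) (use S in auto)
  then show False using n S(2) d by (simp add: field_simps)
qed

lemma supn_nonneg_mem: "f \<in> A \<Longrightarrow> 0 \<le> supn f"
  using cmod_le_supn norm_ge_zero order_trans by blast

lemma eval_dual_space:
  assumes S: "bdd_lin A S' S" and le: "\<And>f. f \<in> A \<Longrightarrow> cmod (S f y) \<le> supn (S f)"
  shows "(\<lambda>f. S f y) \<in> dual_space A"
proof -
  obtain C where "\<forall>f\<in>A. supn (S f) \<le> C * supn f" using bdd_linD(4)[OF S] by blast
  then have "\<forall>f\<in>A. cmod (S f y) \<le> C * supn f" using le order_trans by blast
  then show ?thesis unfolding dual_space_def using bdd_linD(2,3)[OF S] by auto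
qed

lemma eval_op_dual_space: "bdd_lin A A S \<Longrightarrow> (\<lambda>f. S f y) \<in> dual_space A"
  by (rule eval_dual_space) (auto intro: cmod_le_supn bdd_linD(1))

section \<open>Operators with small atoms\<close>

text \<open>Concerns the functional \<open>f \<mapsto> T f s\<close> at the same point
  \<open>s\<close>. In contrast to the negation of \<open>heavy\<close>, only some arbitrarily sharp
  peakers have to be small, not all sufficiently sharp ones.\<close>

definition small_atom :: "(('a \<Rightarrow> complex) \<Rightarrow> ('a \<Rightarrow> complex)) \<Rightarrow> real \<Rightarrow> 'a \<Rightarrow> bool" where
  "small_atom T \<epsilon> s \<longleftrightarrow>
     (\<forall>V e. open V \<and> s \<in> V \<and> e > 0 \<longrightarrow> (\<exists>h\<in>peakers s V e. cmod (T h s) \<le> \<epsilon>))"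

section \<open>Weakly compact operators\<close>

lemma topspace_weak_topology: "topspace (weak_topology A) = A"
proof -
  have "(\<lambda>f. 0) \<in> dual_space A" by (auto simp: dual_space_def intro!: exI[of _ 0])
  then have "{f \<in> A. (0::complex) \<in> UNIV} \<in> {{f \<in> A. \<phi> f \<in> U} |\<phi> U. \<phi> \<in> dual_space A \<and> open U}"
    by blast
  then show ?thesis unfolding weak_topology_def topology_generated_by_topspace by auto
qed

text \<open>The cluster point plays the role of the image of the indicator function of \<open>s\<close> under the
  second adjoint of \<open>T\<close>.\<close>
lemma weakly_compact_cluster_point:
  assumes T: "bdd_lin A A T" and wc: "weakly_compact_op A T" and s: "s \<in> choquet_boundary A"
  shows "\<exists>g\<in>A. \<forall>t V e \<epsilon>. open V \<and> s \<in> V \<and> e > 0 \<and> \<epsilon> > 0 \<longrightarrow>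
    (\<exists>h\<in>peakers s V e. cmod (T h t - g t) < \<epsilon>)"
proof -
  let ?W = "weak_topology A"
  let ?cl = "\<lambda>V e. ?W closure_of (T ` peakers s V e)"
  define C where "C = ?W closure_of (T ` {f \<in> A. supn f \<le> 1})"
  \<comment> \<open>Closed subsets of a weakly compact set, directed by intersecting the
    \<open>V\<close> and taking the minimum of the \<open>e\<close>; a common point \<open>g\<close>
    exists by the finite intersection property.\<close>
  define \<Q> where "\<Q> = {?cl V e | V e. open V \<and> s \<in> V \<and> e > 0}"
  have mem: "T ` peakers s V e \<subseteq> A" for V e using peakersD(1) bdd_linD(1)[OF T] by blast
  have "supn h \<le> 1" if "h \<in> peakers s V e" for h V e using peakersD(2)[OF that] by (rule supn_le)
  then have sub: "?cl V e \<subseteq> C" for V e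
    unfolding C_def by (intro closure_of_mono image_mono) (auto dest: peakersD(1))
  have ne: "?cl V e \<noteq> {}" if "open V" "s \<in> V" "e > 0" for V e
  proof -
    have "T ` peakers s V e \<noteq> {}" using peakers_nonempty[OF s that] by simp
    then show ?thesis
      using closure_of_subset[of "T ` peakers s V e" ?W] mem topspace_weak_topology by auto
  qed
  have fip: "\<exists>V e. open V \<and> s \<in> V \<and> e > 0 \<and> ?cl V e \<subseteq> \<Inter>\<F>" if "finite \<F>" "\<F> \<subseteq> \<Q>" for \<F>
    using that
  proof (induction \<F>)
    case empty
    then show ?case by (intro exI[of _ UNIV] exI[of _ 1]) simp
  next
    case (insert Q \<F>)
    then obtain V e where V: "open V" "s \<in> V" "e > 0" "?cl V e \<subseteq> \<Inter>\<F>" by auto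
    obtain V' e' where V': "open V'" "s \<in> V'" "e' > 0" "Q = ?cl V' e'"
      using insert.prems unfolding \<Q>_def by blast
    have "?cl (V \<inter> V') (min e e') \<subseteq> ?cl V e" "?cl (V \<inter> V') (min e e') \<subseteq> ?cl V' e'"
      by (intro closure_of_mono image_mono peakers_mono; simp)+
    then show ?case using V V' by (intro exI[of _ "V \<inter> V'"] exI[of _ "min e e'"]) auto
  qed
  have "C \<inter> \<Inter>\<Q> \<noteq> {}"
  proof -
    have "compactin ?W C" using wc unfolding weakly_compact_op_def C_def .
    moreover have "\<forall>Q\<in>\<Q>. closedin ?W Q" by (auto simp: \<Q>_def)
    moreover have "C \<inter> \<Inter>\<F> \<noteq> {}" if F: "finite \<F>" "\<F> \<subseteq> \<Q>" for \<F>
    proof -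
      obtain V e where "open V" "s \<in> V" "e > 0" "?cl V e \<subseteq> \<Inter>\<F>" using fip[OF F] by blast
      then show ?thesis using ne[of V e] sub[of V e] by blast
    qed
    ultimately show ?thesis unfolding compactin_fip by blast
  qed
  then obtain g where g: "g \<in> C" "\<And>Q. Q \<in> \<Q> \<Longrightarrow> g \<in> Q" by blast
  have gA: "g \<in> A"
    using g(1) closure_of_subset_topspace[of ?W] topspace_weak_topology unfolding C_def by blast
  show ?thesis
  proof (rule bexI[OF _ gA], intro allI impI)
    fix t V and e \<epsilon> :: real
    assume "open V \<and> s \<in> V \<and> e > 0 \<and> \<epsilon> > 0"
    then have V: "open V" "s \<in> V" "e > 0" and eps: "\<epsilon> > 0" by auto
    then have gcl: "g \<in> ?cl V e" by (intro g(2)) (auto simp: \<Q>_def)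
    \<comment> \<open>Evaluation at \<open>t\<close> is weakly continuous, so this is a weak
      neighbourhood of \<open>g\<close>.\<close>
    have "openin ?W {f \<in> A. f t \<in> ball (g t) \<epsilon>}"
      unfolding weak_topology_def
      by (intro topology_generated_by_Basis CollectI exI[of _ "\<lambda>f. f t"] exI[of _ "ball (g t) \<epsilon>"])
        (use eval_dual_ball[of t] in \<open>auto simp: dual_ball_def\<close>)
    moreover have "g \<in> {f \<in> A. f t \<in> ball (g t) \<epsilon>}" using gA eps by simp
    ultimately obtain f where "f \<in> T ` peakers s V e" "f \<in> {f \<in> A. f t \<in> ball (g t) \<epsilon>}"
      using gcl[unfolded in_closure_of, THEN conjunct2, rule_format, of "{f \<in> A. f t \<in> ball (g t) \<epsilon>}"]
      by blast
    then show "\<exists>h\<in>peakers s V e. cmod (T h t - g t) < \<epsilon>"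
      by (auto simp: dist_norm norm_minus_commute)
  qed
qed

text \<open>Otherwise every boundary point \<open>s\<close> in \<open>U\<close> has a cluster point
  \<open>G s\<close> with modulus at least \<open>\<epsilon>\<close> at \<open>s\<close>. For any
  \<open>n\<close> one finds \<open>n\<close> such points and a common \<open>t\<close> where all
  \<open>G s\<close> are large; then \<open>f \<mapsto> T f t\<close> is heavy at \<open>n\<close>
  points, against \<open>card_heavy_le\<close>.\<close>

lemma weakly_compact_small_atom:
  assumes noiso: "\<forall>k. \<not> isolated_point k (choquet_boundary A)"
    and T: "bdd_lin A A T" and wc: "weakly_compact_op A T"
    and U: "open U" "U \<inter> choquet_boundary A \<noteq> {}" and eps: "\<epsilon> > 0"
  shows "\<exists>s\<in>U \<inter> choquet_boundary A. small_atom T \<epsilon> s"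
proof (rule ccontr)
  assume none: "\<not> ?thesis"
  define clusters where "clusters s g \<longleftrightarrow> (\<forall>t V e \<delta>. open V \<and> s \<in> V \<and> e > 0 \<and> \<delta> > 0 \<longrightarrow>
      (\<exists>h\<in>peakers s V e. cmod (T h t - g t) < \<delta>))" for s g
  have clustersD: "\<exists>h\<in>peakers s V e. cmod (T h t - g t) < \<delta>"
    if "clusters s g" "open V" "s \<in> V" "e > 0" "\<delta> > 0" for s g t V e \<delta>
    using that unfolding clusters_def by blast
  have "\<forall>s\<in>U \<inter> choquet_boundary A. \<exists>g. g \<in> A \<and> clusters s g \<and> \<epsilon> \<le> cmod (g s)"
  proof
    fix s assume s: "s \<in> U \<inter> choquet_boundary A"
    obtain g where g: "g \<in> A" "clusters s g"
      using weakly_compact_cluster_point[OF T wc IntD2[OF s]] unfolding clusters_def by (rule bexE)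
    have "\<not> small_atom T \<epsilon> s" using none s by blast
    then obtain V e where V: "open V" "s \<in> V" "e > 0" and big: "\<And>h. h \<in> peakers s V e \<Longrightarrow> \<epsilon> < cmod (T h s)"
      unfolding small_atom_def by (auto simp: not_le)
    have "\<epsilon> \<le> cmod (g s)"
    proof (rule ccontr)
      assume "\<not> \<epsilon> \<le> cmod (g s)"
      then obtain h where h: "h \<in> peakers s V e" "cmod (T h s - g s) < \<epsilon> - cmod (g s)"
        using clustersD[OF g(2) V, of "\<epsilon> - cmod (g s)" s] by auto
      then show False using big[OF h(1)] norm_triangle_ineq2[of "T h s" "g s"] by linarith
    qed
    then show "\<exists>g. g \<in> A \<and> clusters s g \<and> \<epsilon> \<le> cmod (g s)" using g by blast
  qed
  from bchoice[OF this] obtain G where G: "\<And>s. s \<in> U \<inter> choquet_boundary A \<Longrightarrow> G s \<in> A"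
    "\<And>s. s \<in> U \<inter> choquet_boundary A \<Longrightarrow> clusters s (G s)"
    "\<And>s. s \<in> U \<inter> choquet_boundary A \<Longrightarrow> \<epsilon> \<le> cmod (G s s)"
    by blast
  \<comment> \<open>Each new point is chosen in \<open>W\<close>, where the earlier
    \<open>G s\<close> are large; by continuity of its own function \<open>W\<close> can be shrunk
    around it.\<close>
  have seq: "\<exists>S W. finite S \<and> card S = n \<and> S \<subseteq> U \<inter> choquet_boundary A \<and> open W \<and> W \<subseteq> U \<and>
      W \<inter> choquet_boundary A \<noteq> {} \<and> (\<forall>t\<in>W. \<forall>s\<in>S. \<epsilon> / 2 < cmod (G s t))" for n
  proof (induction n)
    case 0
    then show ?case using U by (intro exI[of _ "{}"] exI[of _ U]) auto
  next
    case (Suc n)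
    then obtain S W where S: "finite S" "card S = n" "S \<subseteq> U \<inter> choquet_boundary A"
      and W: "open W" "W \<subseteq> U" "W \<inter> choquet_boundary A \<noteq> {}"
        "\<And>t s. t \<in> W \<Longrightarrow> s \<in> S \<Longrightarrow> \<epsilon> / 2 < cmod (G s t)" by blast
    obtain s where s: "s \<in> W" "s \<in> choquet_boundary A" "s \<notin> S"
      using choquet_point_avoiding_finite[OF noiso W(1,3) S(1)] by blast
    then have sU: "s \<in> U \<inter> choquet_boundary A" using W(2) by blast
    define W' where "W' = W \<inter> {t. \<epsilon> / 2 < cmod (G s t)}"
    have "open W'" unfolding W'_def
      by (intro open_Int W open_Collect_less continuous_intros cont G(1) sU)
    moreover have "s \<in> W'" using s(1) G(3)[OF sU] eps by (simp add: W'_def)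
    ultimately show ?case
      using S W sU s by (intro exI[of _ "insert s S"] exI[of _ W']) (auto simp: W'_def)
  qed
  obtain C0 where C0: "\<forall>f\<in>A. supn (T f) \<le> C0 * supn f" using bdd_linD(4)[OF T] by blast
  define C where "C = \<bar>C0\<bar>"
  have C: "cmod (T f t) \<le> C * supn f" if "f \<in> A" for f t
  proof -
    have "cmod (T f t) \<le> supn (T f)" by (rule cmod_le_supn[OF bdd_linD(1)[OF T that]])
    also have "\<dots> \<le> C0 * supn f" using C0 that by blast
    also have "\<dots> \<le> C * supn f" unfolding C_def by (rule mult_right_mono[OF abs_ge_self supn_nonneg_mem[OF that]])
    finally show ?thesis .
  qed
  obtain n :: nat where n: "real n > 2 * C / (\<epsilon> / 4)" using reals_Archimedean2 by blast
  obtain S W where S: "finite S" "card S = n" "S \<subseteq> U \<inter> choquet_boundary A"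
    and W: "W \<inter> choquet_boundary A \<noteq> {}" "\<And>t s. t \<in> W \<Longrightarrow> s \<in> S \<Longrightarrow> \<epsilon> / 2 < cmod (G s t)"
    using seq[of n] by blast
  obtain t where t: "t \<in> W" using W(1) by blast
  have "real (card S) * (\<epsilon> / 4) \<le> 2 * C"
  proof (rule card_heavy_le[OF eval_op_dual_space[OF T] C])
    show "C \<ge> 0" by (simp add: C_def)
    show "heavy (\<lambda>f. T f t) (\<epsilon> / 4) s" if s: "s \<in> S" for s
      unfolding heavy_def
    proof (intro allI impI)
      fix V and e :: real assume V: "open V \<and> s \<in> V \<and> e > 0"
      then obtain h where h: "h \<in> peakers s V e" "cmod (T h t - G s t) < \<epsilon> / 4"
        using clustersD[OF G(2), of s V e "\<epsilon> / 4" t] s S(3) eps by auto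
      have "\<epsilon> / 4 \<le> cmod (T h t)"
        using h(2) W(2)[OF t s] norm_triangle_ineq3[of "G s t" "T h t"] by (simp add: norm_minus_commute)
      then show "\<exists>h\<in>peakers s V e. \<epsilon> / 4 \<le> cmod (T h t)" using h(1) by blast
    qed
  qed (simp_all add: S(1))
  then show False using n S(2) eps by (simp add: field_simps)
qed

section \<open>Operators factoring through a subspace of \<open>c0\<close>\<close>

text \<open>At a point where no coordinate functional of \<open>T1\<close> has an atom, one can choose peakers whose
  images in \<open>c0\<close> are almost disjointly supported; their averages have small image.\<close>
lemma c0_averaging:
  assumes T1: "bdd_lin A E T1" and E: "E \<subseteq> c0"
    and light: "\<And>n \<delta>. \<delta> > 0 \<Longrightarrow> \<not> heavy (\<lambda>f. T1 f n) \<delta> s" and s: "s \<in> choquet_boundary A"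
    and V: "open V" "s \<in> V" and e: "e > 0" and d: "\<delta> > 0"
    and C: "\<And>f. f \<in> A \<Longrightarrow> supn (T1 f) \<le> C * supn f" "C \<ge> 0"
  shows "\<exists>h\<in>peakers s V e. \<forall>n. real (Suc m) * cmod (T1 h n) \<le> C + real (Suc m) * \<delta>"
proof -
  have bound: "cmod (T1 h n) \<le> C" if "h \<in> peakers s V e" for h n
  proof -
    have h: "h \<in> A" "supn h \<le> 1" using peakersD(1,2)[OF that] by (auto intro: supn_le)
    have "cmod (T1 h n) \<le> supn (T1 h)" using c0_cmod_le_supn bdd_linD(1)[OF T1 h(1)] E by blast
    also have "\<dots> \<le> C * supn h" by (rule C(1)[OF h(1)])
    also have "\<dots> \<le> C" using h(2) C(2) by (simp add: mult_left_le)
    finally show ?thesis .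
  qed
  \<comment> \<open>Sharp enough peakers are small in finitely many coordinates at once.\<close>
  have simul: "\<exists>V' e'. open V' \<and> s \<in> V' \<and> e' > 0 \<and> (\<forall>h\<in>peakers s V' e'. \<forall>n<N. cmod (T1 h n) < \<delta>)" for N :: nat
  proof (induction N)
    case 0
    then show ?case by (intro exI[of _ UNIV] exI[of _ 1]) simp
  next
    case (Suc N)
    then obtain V1 e1 where 1: "open V1" "s \<in> V1" "e1 > 0" "\<And>h n. h \<in> peakers s V1 e1 \<Longrightarrow> n < N \<Longrightarrow> cmod (T1 h n) < \<delta>"
      by blast
    obtain V2 e2 where 2: "open V2" "s \<in> V2" "e2 > 0" "\<And>h. h \<in> peakers s V2 e2 \<Longrightarrow> cmod (T1 h N) < \<delta>"
      using light[OF d, of N] unfolding heavy_def by force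
    have sub: "peakers s (V1 \<inter> V2) (min e1 e2) \<subseteq> peakers s V1 e1"
      "peakers s (V1 \<inter> V2) (min e1 e2) \<subseteq> peakers s V2 e2"
      by (intro peakers_mono; simp)+
    have "cmod (T1 h n) < \<delta>" if "h \<in> peakers s (V1 \<inter> V2) (min e1 e2)" "n < Suc N" for h n
      using 1(4)[of h n] 2(4)[of h] that sub by (auto simp: less_Suc_eq)
    then show ?case using 1 2 by (intro exI[of _ "V1 \<inter> V2"] exI[of _ "min e1 e2"]) auto
  qed
  show ?thesis
  proof (induction m)
    case 0
    obtain h where "h \<in> peakers s V e" using peakers_nonempty[OF s V e] by blast
    then show ?case using bound[of h] d by (intro bexI[of _ h]) (auto intro: add_increasing2)
  next
    case (Suc m)
    then obtain g where g: "g \<in> peakers s V e" "\<And>n. real (Suc m) * cmod (T1 g n) \<le> C + real (Suc m) * \<delta>" by blast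
    have gA: "g \<in> A" by (rule peakersD(1)[OF g(1)])
    have "(\<lambda>n. T1 g n) \<longlonglongrightarrow> 0" using bdd_linD(1)[OF T1 gA] E by (auto simp: c0_def)
    then have "\<forall>\<^sub>F n in sequentially. dist (T1 g n) 0 < \<delta> / real (Suc m)" using d by (intro tendstoD) auto
    \<comment> \<open>From \<open>N\<close> on even \<open>m + 1\<close> times the current average
      is below \<open>\<delta>\<close>; before \<open>N\<close> the new peaker will be. So no
      coordinate collects the bound \<open>C\<close> twice.\<close>
    then obtain N where N: "\<And>n. n \<ge> N \<Longrightarrow> cmod (T1 g n) < \<delta> / real (Suc m)"
      unfolding eventually_sequentially by auto
    obtain V' e' where V': "open V'" "s \<in> V'" "e' > 0" "\<And>h n. h \<in> peakers s V' e' \<Longrightarrow> n < N \<Longrightarrow> cmod (T1 h n) < \<delta>"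
      using simul[of N] by blast
    have "open (V \<inter> V')" "s \<in> V \<inter> V'" "min e e' > 0" using V V' e by auto
    then obtain h where h: "h \<in> peakers s (V \<inter> V') (min e e')" using peakers_nonempty[OF s] by blast
    have h1: "h \<in> peakers s V e" "h \<in> peakers s V' e'"
      using h peakers_mono[of "V \<inter> V'" V "min e e'" e s] peakers_mono[of "V \<inter> V'" V' "min e e'" e' s] by auto
    have hA: "h \<in> A" by (rule peakersD(1)[OF h])
    \<comment> \<open>The weight that turns an average of \<open>m + 1\<close> peakers and a new one
      into an average of \<open>m + 2\<close>.\<close>
    define t where "t = real (Suc m) / real (Suc (Suc m))"
    have t: "0 \<le> t" "t \<le> 1" "real (Suc (Suc m)) * t = real (Suc m)" "real (Suc (Suc m)) * (1 - t) = 1"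
      unfolding t_def by (auto simp: field_simps)
    define u where "u = (\<lambda>x. of_real t * g x + of_real (1 - t) * h x)"
    have u: "u \<in> peakers s V e" unfolding u_def by (rule peakers_convex[OF g(1) h1(1) t(1,2)])
    have Tu: "T1 u n = of_real t * T1 g n + of_real (1 - t) * T1 h n" for n
      unfolding u_def by (simp only: bdd_linD(2)[OF T1 scale_mem[OF gA] scale_mem[OF hA]]
          bdd_linD(3)[OF T1 gA] bdd_linD(3)[OF T1 hA])
    have "real (Suc (Suc m)) * cmod (T1 u n) \<le> C + real (Suc (Suc m)) * \<delta>" for n
    proof -
      have "cmod (T1 u n) \<le> cmod (of_real t * T1 g n) + cmod (of_real (1 - t) * T1 h n)"
        unfolding Tu by (rule norm_triangle_ineq)
      also have "\<dots> = t * cmod (T1 g n) + (1 - t) * cmod (T1 h n)"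
        using t by (simp add: norm_mult del: of_real_diff)
      finally have "real (Suc (Suc m)) * cmod (T1 u n) \<le>
          real (Suc (Suc m)) * (t * cmod (T1 g n) + (1 - t) * cmod (T1 h n))"
        by (rule mult_left_mono) simp
      also have "\<dots> = (real (Suc (Suc m)) * t) * cmod (T1 g n) + (real (Suc (Suc m)) * (1 - t)) * cmod (T1 h n)"
        by (simp only: distrib_left mult.assoc)
      also have "\<dots> = real (Suc m) * cmod (T1 g n) + cmod (T1 h n)" unfolding t(3,4) by simp
      also have "\<dots> \<le> C + real (Suc (Suc m)) * \<delta>"
      proof (cases "n < N")
        case True
        then show ?thesis using g(2)[of n] V'(4)[OF h1(2) True] by (simp add: algebra_simps)
      next
        case False
        then have "real (Suc m) * cmod (T1 g n) \<le> \<delta>" using N[of n] by (simp add: field_simps)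
        moreover have "\<delta> \<le> real (Suc (Suc m)) * \<delta>" using d by simp
        ultimately show ?thesis using bound[OF h1(1), of n] by linarith
      qed
      finally show ?thesis .
    qed
    then show ?case using u by blast
  qed
qed

text \<open>Each coordinate functional of \<open>T1\<close> is heavy at countably many points only,
  so some boundary point in \<open>U\<close> escapes all of them; averages of peakers there have
  small image under \<open>T1\<close>, hence under \<open>T\<close>.\<close>

lemma c0_small_atom:
  assumes noiso: "\<forall>k. \<not> isolated_point k (choquet_boundary A)"
    and fac: "factors_through_c0_subspace A T"
    and U: "open U" "U \<inter> choquet_boundary A \<noteq> {}" and eps: "\<epsilon> > 0"
  shows "\<exists>s\<in>U \<inter> choquet_boundary A. small_atom T \<epsilon> s"
proof -
  obtain E T1 T2 where E: "E \<subseteq> c0" and T1: "bdd_lin A E T1" and T2: "bdd_lin E A T2"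
    and T: "\<And>f. f \<in> A \<Longrightarrow> T f = T2 (T1 f)"
    using fac unfolding factors_through_c0_subspace_def by blast
  obtain C1 where C1: "\<forall>f\<in>A. supn (T1 f) \<le> C1 * supn f" using bdd_linD(4)[OF T1] by blast
  obtain C2 where C2: "\<forall>x\<in>E. supn (T2 x) \<le> C2 * supn x" using bdd_linD(4)[OF T2] by blast
  have C1': "supn (T1 f) \<le> \<bar>C1\<bar> * supn f" if "f \<in> A" for f
    using C1 that mult_right_mono[OF abs_ge_self supn_nonneg_mem[OF that]] order_trans by blast
  define D where "D = (\<Union>n. \<Union>m. {s. heavy (\<lambda>f. T1 f n) (1 / real (Suc m)) s})"
  have dual: "(\<lambda>f. T1 f n) \<in> dual_space A" for n
    using E bdd_linD(1)[OF T1] by (intro eval_dual_space[OF T1] c0_cmod_le_supn) blast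
  have "countable D" unfolding D_def
    by (intro countable_UN[OF countableI_type] countable_finite finite_heavy[OF dual]) simp
  then obtain s where s: "s \<in> U" "s \<in> choquet_boundary A" "s \<notin> D"
    using choquet_point_avoiding_countable[OF noiso U] by blast
  have light: "\<not> heavy (\<lambda>f. T1 f n) \<delta> s" if "\<delta> > 0" for n \<delta>
  proof
    assume h: "heavy (\<lambda>f. T1 f n) \<delta> s"
    obtain m where m: "1 / real (Suc m) < \<delta>" using \<open>\<delta> > 0\<close> nat_approx_posE by blast
    have "heavy (\<lambda>f. T1 f n) (1 / real (Suc m)) s"
      unfolding heavy_def
    proof (intro allI impI)
      fix V and e :: real assume "open V \<and> s \<in> V \<and> e > 0"
      then obtain h where "h \<in> peakers s V e" "\<delta> \<le> cmod (T1 h n)" using h unfolding heavy_def by blast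
      then show "\<exists>h\<in>peakers s V e. 1 / real (Suc m) \<le> cmod (T1 h n)" using m by (intro bexI[of _ h]) auto
    qed
    then show False using s(3) unfolding D_def by blast
  qed
  have "small_atom T \<epsilon> s" unfolding small_atom_def
  proof (intro allI impI)
    fix V and e :: real assume V: "open V \<and> s \<in> V \<and> e > 0"
    \<comment> \<open>Chosen for \<open>(\<bar>C2\<bar> + 1) (2 \<delta>) = \<epsilon>\<close>,
      where one \<open>\<delta>\<close> comes from \<open>c0_averaging\<close> and the other bounds
      \<open>\<bar>C1\<bar> / (m + 1)\<close>.\<close>
    define \<delta> where "\<delta> = \<epsilon> / (2 * (\<bar>C2\<bar> + 1))"
    have \<delta>: "\<delta> > 0" using eps by (simp add: \<delta>_def add_nonneg_pos)
    obtain m :: nat where m: "real m \<ge> \<bar>C1\<bar> / \<delta>" using real_arch_simple by blast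
    have "\<exists>h\<in>peakers s V e. \<forall>n. real (Suc m) * cmod (T1 h n) \<le> \<bar>C1\<bar> + real (Suc m) * \<delta>"
      by (rule c0_averaging[OF T1 E light s(2) _ _ _ \<delta> C1']) (use V in auto)
    then obtain h where h: "h \<in> peakers s V e" "\<And>n. real (Suc m) * cmod (T1 h n) \<le> \<bar>C1\<bar> + real (Suc m) * \<delta>"
      by blast
    have hA: "h \<in> A" by (rule peakersD(1)[OF h(1)])
    have Th: "T1 h \<in> E" by (rule bdd_linD(1)[OF T1 hA])
    have "cmod (T1 h n) \<le> 2 * \<delta>" for n
    proof -
      have "\<bar>C1\<bar> \<le> real m * \<delta>" using m \<delta> by (simp add: field_simps)
      then have "\<bar>C1\<bar> \<le> real (Suc m) * \<delta>" using \<delta> by (simp add: algebra_simps)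
      then have "real (Suc m) * cmod (T1 h n) \<le> real (Suc m) * (2 * \<delta>)" using h(2)[of n] by linarith
      then show ?thesis by (rule mult_left_le_imp_le) simp
    qed
    then have sup: "supn (T1 h) \<le> 2 * \<delta>" "0 \<le> supn (T1 h)" by (rule supn_le, rule supn_nonneg)
    have "cmod (T h s) \<le> supn (T2 (T1 h))"
      unfolding T[OF hA] by (rule cmod_le_supn[OF bdd_linD(1)[OF T2 Th]])
    also have "\<dots> \<le> C2 * supn (T1 h)" using C2 Th by blast
    also have "\<dots> \<le> (\<bar>C2\<bar> + 1) * (2 * \<delta>)" using sup by (intro mult_mono) auto
    also have "\<dots> = \<epsilon>" by (simp add: \<delta>_def field_simps)
    finally show "\<exists>h\<in>peakers s V e. cmod (T h s) \<le> \<epsilon>" using h(1) by blast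
  qed
  then show ?thesis using s by blast
qed

section \<open>The Daugavet equation\<close>

lemma cmod_le_opnorm:
  assumes S: "bdd_lin A A S" and f: "f \<in> A" "\<And>x. cmod (f x) \<le> c" and c: "c > 0"
  shows "cmod (S f y) \<le> opnorm A S * c"
proof -
  obtain C where C: "\<forall>f\<in>A. supn (S f) \<le> C * supn f" using bdd_linD(4)[OF S] by blast
  have bdd: "bdd_above {supn (S f) | f. f \<in> A \<and> supn f \<le> 1}"
  proof (rule bdd_aboveI)
    fix r assume "r \<in> {supn (S f) | f. f \<in> A \<and> supn f \<le> 1}"
    then obtain f where f: "r = supn (S f)" "f \<in> A" "supn f \<le> 1" by blast
    have "C * supn f \<le> \<bar>C\<bar> * 1"
      using f supn_nonneg_mem[OF f(2)] by (intro mult_mono) auto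
    moreover have "supn (S f) \<le> C * supn f" using C f(2) by blast
    ultimately show "r \<le> \<bar>C\<bar>" using f(1) by simp
  qed
  define g where "g = (\<lambda>x. of_real (1 / c) * f x)"
  have g: "g \<in> A" unfolding g_def by (rule scale_mem[OF f(1)])
  have "cmod (g x) \<le> 1" for x using f(2)[of x] c by (simp add: g_def norm_mult norm_divide field_simps)
  then have "supn g \<le> 1" by (rule supn_le)
  then have "supn (S g) \<le> opnorm A S"
    unfolding opnorm_def using g by (intro cSup_upper bdd) blast
  then have "cmod (S g y) \<le> opnorm A S"
    using cmod_le_supn[OF bdd_linD(1)[OF S g], of y] by linarith
  moreover have "cmod (S g y) = cmod (S f y) / c"
    unfolding g_def bdd_linD(3)[OF S f(1)] using c by (simp add: norm_mult norm_divide)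
  ultimately show ?thesis using c by (simp add: field_simps)
qed

lemma opnorm_le:
  assumes "\<And>f x. f \<in> A \<Longrightarrow> (\<And>x. cmod (f x) \<le> 1) \<Longrightarrow> cmod (S f x) \<le> c"
  shows "opnorm A S \<le> c"
  unfolding opnorm_def
proof (rule cSup_least)
  have "supn (S (\<lambda>x. 0)) \<in> {supn (S f) | f. f \<in> A \<and> supn f \<le> 1}"
    using const_mem[of 0] supn_le[of "\<lambda>x::'a. 0" 1] by force
  then show "{supn (S f) | f. f \<in> A \<and> supn f \<le> 1} \<noteq> {}" by blast
  fix r assume "r \<in> {supn (S f) | f. f \<in> A \<and> supn f \<le> 1}"
  then obtain f where f: "r = supn (S f)" "f \<in> A" "supn f \<le> 1" by blast
  have "cmod (f x) \<le> 1" for x using cmod_le_supn[OF f(2), of x] f(3) by linarith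
  then show "r \<le> c" unfolding f(1) by (intro supn_le assms f(2))
qed

lemma bdd_lin_id_plus:
  assumes T: "bdd_lin A A T"
  shows "bdd_lin A A (\<lambda>f x. f x + T f x)"
proof -
  obtain C where C: "\<forall>f\<in>A. supn (T f) \<le> C * supn f" using bdd_linD(4)[OF T] by blast
  have "supn (\<lambda>x. f x + T f x) \<le> (1 + C) * supn f" if f: "f \<in> A" for f
  proof (rule supn_le)
    fix x
    have "cmod (T f x) \<le> C * supn f"
      using cmod_le_supn[OF bdd_linD(1)[OF T f], of x] C f order_trans by blast
    then show "cmod (f x + T f x) \<le> (1 + C) * supn f"
      using norm_triangle_ineq[of "f x" "T f x"] cmod_le_supn[OF f, of x] by (simp add: algebra_simps)
  qed
  then show ?thesis unfolding bdd_lin_def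
    using bdd_linD(1,2,3)[OF T] by (auto simp: algebra_simps intro: add_mem intro!: exI[of _ "1 + C"])
qed

text \<open>The test function is \<open>g = f (1 - h) + \<theta> h = f + (\<theta> - f s) h + (f s -
  f) h\<close>. Its value at \<open>s\<close> is nearly \<open>\<theta>\<close>, and
  \<open>T g s\<close> is nearly \<open>T f s\<close>: the second summand has small image at
  \<open>s\<close> by the choice of \<open>h\<close>, the third is small in norm as \<open>f\<close>
  is nearly constant on \<open>V\<close>.\<close>

lemma Daugavet_estimate:
  assumes T: "bdd_lin A A T" and f: "f \<in> A" "\<And>x. cmod (f x) \<le> 1"
    and s: "small_atom T e s" and e: "e > 0"
  shows "1 + cmod (T f s) - (4 + 2 * opnorm A T) * e \<le> opnorm A (\<lambda>f x. f x + T f x) * (1 + e)"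
proof -
  obtain c where c: "cmod c = 1" "c * T f s = of_real (cmod (T f s))" using ex_unimodular by blast
  \<comment> \<open>A phase of \<open>T f s\<close>, so that \<open>\<theta> + T f s\<close> has
    modulus \<open>1 + cmod (T f s)\<close>.\<close>
  define \<theta> where "\<theta> = cnj c"
  have \<theta>: "cmod \<theta> = 1" by (simp add: \<theta>_def c)
  have c\<theta>: "c * \<theta> = 1" using complex_norm_square[of c] c(1) by (simp add: \<theta>_def)
  define V where "V = {x. cmod (f x - f s) < e}"
  have "open V" unfolding V_def by (intro open_Collect_less continuous_intros cont f)
  moreover have "s \<in> V" using e by (simp add: V_def)
  ultimately obtain h where h: "h \<in> peakers s V e" "cmod (T h s) \<le> e"
    using s e unfolding small_atom_def by blast
  note hp = peakersD[OF h(1)]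
  define g1 where "g1 = (\<lambda>x. (f s - f x) * h x)"
  have g1: "g1 \<in> A" unfolding g1_def by (intro mem_intros f hp)
  have g1_le: "cmod (g1 x) \<le> 2 * e" for x
  proof (cases "x \<in> V")
    case True
    then have "cmod (g1 x) \<le> e * 1"
      unfolding g1_def norm_mult using hp(2)[of x] e
      by (intro mult_mono) (auto simp: V_def norm_minus_commute)
    then show ?thesis using e by simp
  next
    case False
    have "cmod (f s - f x) \<le> 2" using norm_triangle_ineq4[of "f s" "f x"] f(2)[of s] f(2)[of x] by linarith
    then show ?thesis unfolding g1_def norm_mult using hp(4)[OF False] by (intro mult_mono) auto
  qed
  define g where "g = (\<lambda>x. f x + ((\<theta> - f s) * h x + g1 x))"
  have g: "g \<in> A" unfolding g_def by (intro mem_intros f hp g1)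
  have g_eq: "g x = f x * (1 - h x) + \<theta> * h x" for x by (simp add: g_def g1_def algebra_simps)
  have "cmod (g x) \<le> 1 + e" for x
  proof -
    have "cmod (g x) \<le> cmod (f x) * cmod (1 - h x) + cmod \<theta> * cmod (h x)"
      unfolding g_eq using norm_triangle_ineq[of "f x * (1 - h x)" "\<theta> * h x"] by (simp add: norm_mult)
    also have "\<dots> \<le> 1 * cmod (1 - h x) + 1 * cmod (h x)"
      using f(2)[of x] \<theta> by (intro add_mono mult_right_mono) auto
    finally show ?thesis using hp(5)[of x] by simp
  qed
  then have up: "cmod (g s + T g s) \<le> opnorm A (\<lambda>f x. f x + T f x) * (1 + e)"
    using cmod_le_opnorm[OF bdd_lin_id_plus[OF T] g, of "1 + e" s] e by simp
  have Tg: "T g s = T f s + ((\<theta> - f s) * T h s + T g1 s)"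
    unfolding g_def by (simp only: bdd_linD(2)[OF T f(1) add_mem[OF scale_mem[OF hp(1)] g1]]
        bdd_linD(2)[OF T scale_mem[OF hp(1)] g1] bdd_linD(3)[OF T hp(1)])
  have fs: "cmod (\<theta> - f s) \<le> 2" using norm_triangle_ineq4[of \<theta> "f s"] f(2)[of s] \<theta> by linarith
  have 1: "cmod ((\<theta> - f s) * T h s) \<le> 2 * e"
    unfolding norm_mult using fs h(2) by (intro mult_mono) auto
  have 2: "cmod (T g1 s) \<le> opnorm A T * (2 * e)"
    by (rule cmod_le_opnorm[OF T g1 g1_le]) (use e in simp)
  have "g s - \<theta> = - ((\<theta> - f s) * (1 - h s))" by (simp add: g_eq algebra_simps)
  then have "cmod (g s - \<theta>) = cmod (\<theta> - f s) * cmod (1 - h s)" by (simp add: norm_mult)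
  also have "\<dots> \<le> 2 * e" using fs hp(3) by (intro mult_mono) auto
  finally have 3: "cmod (g s - \<theta>) \<le> 2 * e" .
  have "c * (\<theta> + T f s) = of_real (1 + cmod (T f s))" using c(2) c\<theta> by (simp add: distrib_left)
  then have "cmod c * cmod (\<theta> + T f s) = 1 + cmod (T f s)"
    unfolding norm_mult[symmetric] by (simp only: norm_of_real) simp
  then have 4: "cmod (\<theta> + T f s) = 1 + cmod (T f s)" using c(1) by simp
  have "\<theta> + T f s = (g s + T g s) - ((g s - \<theta>) + ((\<theta> - f s) * T h s + T g1 s))" unfolding Tg by simp
  then have "cmod (\<theta> + T f s) \<le> cmod (g s + T g s) + cmod ((g s - \<theta>) + ((\<theta> - f s) * T h s + T g1 s))"
    by (metis norm_triangle_ineq4)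
  also have "cmod ((g s - \<theta>) + ((\<theta> - f s) * T h s + T g1 s)) \<le> 2 * e + (2 * e + opnorm A T * (2 * e))"
    by (intro norm_triangle_le add_mono 1 2 3 order_trans[OF norm_triangle_ineq])
  finally show ?thesis using up 4 by (simp add: algebra_simps)
qed

text \<open>The points where \<open>T f\<close> is almost as large as at \<open>x\<close> form an
  open set that meets the Choquet boundary. \<open>Daugavet_estimate\<close> at a point with small
  atom in it gives the lower bound as \<open>e\<close> tends to 0.\<close>

lemma Daugavet_equation:
  assumes T: "bdd_lin A A T"
    and small: "\<And>U \<epsilon>. open U \<Longrightarrow> U \<inter> choquet_boundary A \<noteq> {} \<Longrightarrow> \<epsilon> > 0 \<Longrightarrow>
      \<exists>s\<in>U \<inter> choquet_boundary A. small_atom T \<epsilon> s"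
  shows "opnorm A (\<lambda>f x. f x + T f x) = 1 + opnorm A T"
proof (rule antisym)
  let ?N = "opnorm A (\<lambda>f x. f x + T f x)"
  show "?N \<le> 1 + opnorm A T"
  proof (rule opnorm_le)
    fix f x assume f: "f \<in> A" "\<And>x. cmod (f x) \<le> 1"
    then show "cmod (f x + T f x) \<le> 1 + opnorm A T"
      using cmod_le_opnorm[OF T f, of x] norm_triangle_ineq[of "f x" "T f x"] add_mono[OF f(2)[of x]]
        order_trans by fastforce
  qed
  have low: "1 + cmod (T f x) \<le> ?N" if f: "f \<in> A" "\<And>x. cmod (f x) \<le> 1" for f x
  proof -
    have est: "1 + cmod (T f x) - (5 + 2 * opnorm A T) * e \<le> ?N * (1 + e)" if e: "e > 0" for e
    proof -
      \<comment> \<open>Rotating \<open>T f x\<close> onto the positive axis lets a maximum of a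
        real part, attained on the boundary, dominate the modulus at \<open>x\<close>.\<close>
      obtain c where c: "cmod c = 1" "c * T f x = of_real (cmod (T f x))" using ex_unimodular by blast
      have TA: "T f \<in> A" by (rule bdd_linD(1)[OF T f(1)])
      obtain k where k: "k \<in> choquet_boundary A" "\<And>y. Re (c * T f y) \<le> Re (c * T f k)"
        using ex_argmax_choquet[OF scale_mem[OF TA, of c]] by blast
      have "cmod (T f x) = Re (c * T f x)" using c by simp
      also have "\<dots> \<le> Re (c * T f k)" by (rule k(2))
      also have "\<dots> \<le> cmod (T f k)" using complex_Re_le_cmod[of "c * T f k"] c(1) by (simp add: norm_mult)
      finally have le: "cmod (T f x) \<le> cmod (T f k)" .
      define U where "U = {y. cmod (T f x) - e < cmod (T f y)}"
      have "open U" unfolding U_def by (intro open_Collect_less continuous_intros cont TA)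
      moreover have "k \<in> U" using le e by (simp add: U_def)
      ultimately obtain s where s: "s \<in> U" "small_atom T e s" using small[of U e] k(1) e by blast
      have "cmod (T f x) - e < cmod (T f s)" using s(1) by (simp add: U_def)
      then show ?thesis using Daugavet_estimate[OF T f s(2) e] by (simp add: algebra_simps)
    qed
    have "((\<lambda>e. 1 + cmod (T f x) - (5 + 2 * opnorm A T) * e) \<longlongrightarrow> 1 + cmod (T f x) - (5 + 2 * opnorm A T) * 0)
        (at_right 0)" by (intro tendsto_intros)
    moreover have "((\<lambda>e. ?N * (1 + e)) \<longlongrightarrow> ?N * (1 + 0)) (at_right 0)" by (intro tendsto_intros)
    moreover have "\<forall>\<^sub>F e in at_right 0. 1 + cmod (T f x) - (5 + 2 * opnorm A T) * e \<le> ?N * (1 + e)"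
      using est by (auto simp: eventually_at_right_less intro!: eventually_mono[OF eventually_at_right_less])
    ultimately have "1 + cmod (T f x) - (5 + 2 * opnorm A T) * 0 \<le> ?N * (1 + 0)"
      by (intro tendsto_le[OF trivial_limit_at_right_real])
    then show ?thesis by simp
  qed
  have "opnorm A T \<le> ?N - 1"
    by (rule opnorm_le, rule le_diff_eq[THEN iffD2], subst add.commute, rule low)
  then show "1 + opnorm A T \<le> ?N" by simp
qed

end

theorem theorem3p3:
  fixes A :: "('a::t2_space \<Rightarrow> complex) set"
    and T :: "('a \<Rightarrow> complex) \<Rightarrow> ('a \<Rightarrow> complex)"
  assumes "compact (UNIV :: 'a set)"
    and "function_algebra A"
    and "\<forall>k. \<not> isolated_point k (choquet_boundary A)"
    and "bdd_lin A A T"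
    and "weakly_compact_op A T \<or> factors_through_c0_subspace A T"
  shows "opnorm A (\<lambda>f x. f x + T f x) = 1 + opnorm A T"
proof -
  interpret compact_function_algebra A by unfold_locales (fact assms(1), fact assms(2))
  show ?thesis
  proof (rule Daugavet_equation[OF assms(4)])
    fix U :: "'a set" and \<epsilon> :: real
    assume "open U" "U \<inter> choquet_boundary A \<noteq> {}" "\<epsilon> > 0"
    then show "\<exists>s\<in>U \<inter> choquet_boundary A. small_atom T \<epsilon> s"
      using assms(5) weakly_compact_small_atom[OF assms(3,4)] c0_small_atom[OF assms(3)] by blast
  qed
qed

end
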